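(* Let $k\geq 4$ and $\ell\geq 3$ be integers, $t=\lfloor\frac{\ell-1}{2}\rfloor$, $s=k\ell$. For every function $g(n)=o(n^{k-1})$ there exist a function $h(n)=o(n)$ and an integer $n_1$ such that for all $n\geq n_1$ the following holds: if $\mathcal{F}$ is a family of $k$-subsets of $[n]$ that is centralized with threshold $s$, does not contain $\mathbb{C}^{(k)}_\ell$, and satisfies $|\mathcal{F}|\geq t\binom{n}{k-1}-g(n)$, then there exist disjoint sets $S,T\subseteq[n]$ with $|S|=t$ and $|T|\geq n-h(n)$ such that $\{a,x\}\in\mathrm{Ker}^{(2)}_s(\mathcal{F})$ for every $a\in S$ and $x\in T$.
   Context: Kernel degree: $\deg^*_{\mathcal{F}}(D)$ is the largest $s$ such that $\mathcal{F}$ contains $s$ members pairwise intersecting exactly in $D$ and each strictly containing $D$; $\mathrm{Ker}_s(\mathcal{F})=\{D:\deg^*_{\mathcal{F}}(D)\geq s\}$ and $\mathrm{Ker}^{(2)}_s(\mathcal{F})$ is the set of its $2$-element members. $\mathcal{F}$ is centralized with threshold $s$ if for every $F\in\mathcal{F}$ there is $c(F)\in F$ such that every proper subset of $F$ containing $c(F)$ lies in $\mathrm{Ker}_s(\mathcal{F})$. $\mathbb{C}^{(k)}_\ell$: $k$-sets $F_1,\dots,F_\ell$ and distinct vertices $v_1,\dots,v_\ell$ with $F_i\cap\{v_1,\dots,v_\ell\}=\{v_i,v_{i+1}\}$ (indices mod $\ell$) and the $F_i\setminus\{v_1,\dots,v_\ell\}$ pairwise disjoint. *)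

theory Defs
  imports Complex_Main "HOL-Library.Landau_Symbols"
begin

definition k_subsets :: "nat \<Rightarrow> nat \<Rightarrow> nat set set" where
  "k_subsets n k = {A. A \<subseteq> {1..n} \<and> card A = k}"

definition sunflower_with_kernel :: "'a set \<Rightarrow> 'a set set \<Rightarrow> bool" where
  "sunflower_with_kernel D G \<longleftrightarrow>
     (\<forall>A\<in>G. D \<subset> A) \<and> (\<forall>A\<in>G. \<forall>B\<in>G. A \<noteq> B \<longrightarrow> A \<inter> B = D)"

text \<open>Meaningful for finite \<open>\<F>\<close>: the maximum then ranges over a finite set that contains 0,
  because the empty subfamily qualifies.\<close>
definition kernel_degree :: "'a set set \<Rightarrow> 'a set \<Rightarrow> nat" where
  "kernel_degree \<F> D = Max {card G | G. G \<subseteq> \<F> \<and> sunflower_with_kernel D G}"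

definition Ker :: "nat \<Rightarrow> 'a set set \<Rightarrow> 'a set set" where
  "Ker s \<F> = {D. kernel_degree \<F> D \<ge> s}"

definition Ker2 :: "nat \<Rightarrow> 'a set set \<Rightarrow> 'a set set" where
  "Ker2 s \<F> = {D \<in> Ker s \<F>. card D = 2}"

definition centralized :: "nat \<Rightarrow> 'a set set \<Rightarrow> bool" where
  "centralized s \<F> \<longleftrightarrow>
     (\<forall>F\<in>\<F>. \<exists>c\<in>F. \<forall>D. D \<subset> F \<and> c \<in> D \<longrightarrow> D \<in> Ker s \<F>)"

text \<open>Vertices and edges are indexed by \<open>{0..<l}\<close>. For \<open>l \<ge> 3\<close> the
  edges are automatically distinct, since their traces on the vertices \<open>v i\<close> are.\<close>
definition linear_cycle :: "nat \<Rightarrow> nat \<Rightarrow> (nat \<Rightarrow> 'a set) \<Rightarrow> (nat \<Rightarrow> 'a) \<Rightarrow> bool" where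
  "linear_cycle k l E v \<longleftrightarrow>
     inj_on v {0..<l} \<and>
     (\<forall>i<l. finite (E i) \<and> card (E i) = k) \<and>
     (\<forall>i<l. E i \<inter> v ` {0..<l} = {v i, v (Suc i mod l)}) \<and>
     (\<forall>i<l. \<forall>j<l. i \<noteq> j \<longrightarrow> (E i - v ` {0..<l}) \<inter> (E j - v ` {0..<l}) = {})"

definition contains_linear_cycle :: "nat \<Rightarrow> nat \<Rightarrow> 'a set set \<Rightarrow> bool" where
  "contains_linear_cycle k l \<F> \<longleftrightarrow>
     (\<exists>E v. linear_cycle k l E v \<and> (\<forall>i<l. E i \<in> \<F>))"

end

theory Submission
  imports Defs
begin

text \<open>
  A set \<open>D\<close> in the kernel can be completed to a member of the family avoiding any prescribed small
  set, so a cycle of length \<open>l\<close> in the graph of kernel pairs expands to a linear cycle; one cycle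
  edge \<open>{x, y}\<close> may also come from a kernel triple \<open>{c, x, y}\<close> with \<open>c\<close> off the cycle, which
  settles odd \<open>l\<close>. Hence, if \<open>t + 1\<close> vertices have at least \<open>t + 1\<close> common kernel neighbours, no
  member centred at one of them has two other vertices among these neighbours. Let \<open>R c\<close> be the set
  of pairs \<open>{x, y}\<close> lying in \<open>A - {c}\<close> for a member \<open>A\<close> centred at \<open>c\<close>. A pair therefore lies in more
  than \<open>t\<close> of the sets \<open>R c\<close>, \<open>c \<in> H\<close>, only boundedly often for bounded \<open>H\<close>, so
  \<open>|R c| \<ge> \<eta>\<^sup>2 n\<^sup>2\<close> holds for boundedly many heavy centres, whose \<open>|R c|\<close> add up to at most
  \<open>t (n choose 2) + O(1)\<close>.

  Members with a light centre are negligible. If a nonempty subfamily had the property that in each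
  member at least one of any two adjacent noncentral pairs is extendable inside the subfamily in
  many ways, cycles of every length could be grown from a triangle or a 4-cycle. So all members can
  be peeled off, each one along two adjacent pairs blocked by boundedly many vertices, and
  the members peeled off in this way that have light centres number only \<open>O(\<eta> n^(k-1))\<close>.

  Finally, if \<open>d\<close> is the degree of \<open>c\<close> in the kernel graph, at most
  \<open>(n choose (k-1)) * (|R c| / (n choose 2)) * (d / n)\<close> members are centred at \<open>c\<close>. As the middle factors
  sum to about \<open>t\<close> and the products to at least about \<open>t\<close>, there are \<open>t\<close> centres of degree almost \<open>n\<close>.
\<close>

section \<open>Sunflowers and avoidance of small sets\<close>

lemma KerE:
  assumes "finite \<F>" "D \<in> Ker s \<F>"
  obtains G where "G \<subseteq> \<F>" "sunflower_with_kernel D G" "s \<le> card G"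
proof -
  let ?X = "{card G | G. G \<subseteq> \<F> \<and> sunflower_with_kernel D G}"
  have "?X \<subseteq> card ` Pow \<F>" by auto
  hence "finite ?X" using assms(1) by (meson finite_Pow_iff finite_imageI finite_subset)
  moreover have "sunflower_with_kernel D {}" unfolding sunflower_with_kernel_def by simp
  hence "\<exists>G. 0 = card G \<and> G \<subseteq> \<F> \<and> sunflower_with_kernel D G"
    by (intro exI[of _ "{}"]) simp
  hence "0 \<in> ?X" by blast
  ultimately have "Max ?X \<in> ?X" by (intro Max_in) auto
  moreover have "s \<le> Max ?X" using assms(2) unfolding Ker_def kernel_degree_def by simp
  ultimately show ?thesis using that by auto
qed

text \<open>Outside \<open>D\<close> the members of a sunflower are pairwise disjoint, so each
  vertex of \<open>U - D\<close> spoils at most one of them, and fewer than \<open>s\<close> are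
  spoiled in total.\<close>

lemma sunflower_avoids:
  assumes "finite \<F>" "D \<in> Ker s \<F>" "finite U" "card U < s"
  obtains A where "A \<in> \<F>" "D \<subseteq> A" "A \<inter> U \<subseteq> D"
proof -
  obtain G where G: "G \<subseteq> \<F>" "sunflower_with_kernel D G" "s \<le> card G"
    using KerE[OF assms(1,2)] by metis
  have "\<exists>A\<in>G. A \<inter> U \<subseteq> D"
  proof (rule ccontr)
    assume "\<not> ?thesis"
    hence "\<forall>A\<in>G. \<exists>u. u \<in> A \<inter> U - D" by blast
    then obtain f where f: "\<And>A. A \<in> G \<Longrightarrow> f A \<in> A \<inter> U - D" by metis
    have "inj_on f G"
    proof (rule inj_onI, rule ccontr)
      fix A B assume AB: "A \<in> G" "B \<in> G" "f A = f B" "A \<noteq> B"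
      hence "A \<inter> B = D" using G(2) unfolding sunflower_with_kernel_def by blast
      thus False using f[OF AB(1)] f[OF AB(2)] AB(3) by auto
    qed
    moreover have "f ` G \<subseteq> U" using f by blast
    ultimately have "card G \<le> card U" using assms(3) by (metis card_inj_on_le)
    thus False using G(3) assms(4) by simp
  qed
  then obtain A where A: "A \<in> G" "A \<inter> U \<subseteq> D" by blast
  moreover have "D \<subseteq> A" using A(1) G(2) unfolding sunflower_with_kernel_def by auto
  ultimately show ?thesis using that G(1) by auto
qed

lemma card_UN_le_sum:
  fixes b :: "'i \<Rightarrow> real"
  assumes "finite I" "\<And>i. i \<in> I \<Longrightarrow> real (card (X i)) \<le> b i"
  shows "real (card (\<Union>i\<in>I. X i)) \<le> (\<Sum>i\<in>I. b i)"
proof -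
  have "real (card (\<Union>i\<in>I. X i)) \<le> real (\<Sum>i\<in>I. card (X i))"
    using card_UN_le[OF assms(1), of X] by (rule of_nat_mono)
  also have "\<dots> \<le> (\<Sum>i\<in>I. b i)" using assms(2) by (simp add: sum_mono)
  finally show ?thesis .
qed

lemma card_UN_le_mult:
  assumes "finite I" "\<And>i. i \<in> I \<Longrightarrow> real (card (X i)) \<le> b"
  shows "real (card (\<Union>i\<in>I. X i)) \<le> real (card I) * b"
  using card_UN_le_sum[OF assms(1), of X "\<lambda>_. b"] assms(2) by simp

section \<open>Expanding paths of flexible pairs to linear cycles\<close>

locale centralized_family =
  fixes V :: "'a set" and k l :: nat and \<F> :: "'a set set" and ctr :: "'a set \<Rightarrow> 'a"
  assumes finite_V: "finite V" and k4: "4 \<le> k" and l3: "3 \<le> l"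
    and edge_sub: "A \<in> \<F> \<Longrightarrow> A \<subseteq> V" and card_edge: "A \<in> \<F> \<Longrightarrow> card A = k"
    and ctr_in: "A \<in> \<F> \<Longrightarrow> ctr A \<in> A"
    and ctr_Ker: "A \<in> \<F> \<Longrightarrow> D \<subset> A \<Longrightarrow> ctr A \<in> D \<Longrightarrow> D \<in> Ker (k * l) \<F>"
    and no_cycle: "\<not> contains_linear_cycle k l \<F>"
begin

lemma finite_F: "finite \<F>"
  by (rule finite_subset[of _ "Pow V"]) (use edge_sub finite_V in auto)

lemma finite_edge: "A \<in> \<F> \<Longrightarrow> finite A"
  by (rule finite_subset[OF edge_sub finite_V])

text \<open>This consequence of kernel membership is all that the expansion uses. It also covers the
  rich pairs introduced later, which are not known to lie in the kernel.\<close>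

definition flexible :: "'a set \<Rightarrow> bool" where
  "flexible D \<longleftrightarrow> (\<forall>U. finite U \<and> card U < k * l \<longrightarrow> (\<exists>A\<in>\<F>. D \<subseteq> A \<and> A \<inter> U \<subseteq> D))"

lemma flexibleE:
  assumes "flexible D" "finite U" "card U < k * l"
  obtains A where "A \<in> \<F>" "D \<subseteq> A" "A \<inter> U \<subseteq> D"
  using assms unfolding flexible_def by auto

lemma Ker_flexible: "D \<in> Ker (k * l) \<F> \<Longrightarrow> flexible D"
  unfolding flexible_def
proof (intro allI impI)
  fix U :: "'a set"
  assume D: "D \<in> Ker (k * l) \<F>" and U: "finite U \<and> card U < k * l"
  then obtain A where "A \<in> \<F>" "D \<subseteq> A" "A \<inter> U \<subseteq> D"
    using sunflower_avoids[OF finite_F D, of U] by auto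
  thus "\<exists>A\<in>\<F>. D \<subseteq> A \<and> A \<inter> U \<subseteq> D" by auto
qed

lemma ctr_pair_Ker:
  assumes "A \<in> \<F>" "x \<in> A - {ctr A}"
  shows "{ctr A, x} \<in> Ker (k * l) \<F>"
proof (rule ctr_Ker[OF assms(1)])
  have "card {ctr A, x} \<noteq> card A" using card_edge[OF assms(1)] k4 by (simp add: card_insert_if)
  thus "{ctr A, x} \<subset> A" using ctr_in assms by auto
qed simp

text \<open>By \<open>k >= 4\<close> a triple is still a proper subset of the member. For odd
  \<open>l\<close> this allows a closing edge that carries its centre off the cycle.\<close>

lemma ctr_triple_flexible:
  assumes "A \<in> \<F>" "x \<in> A" "y \<in> A"
  shows "flexible {ctr A, x, y}"
proof (rule Ker_flexible, rule ctr_Ker[OF assms(1)])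
  have "card {ctr A, x, y} \<noteq> card A" using card_edge[OF assms(1)] k4 by (simp add: card_insert_if)
  thus "{ctr A, x, y} \<subset> A" using ctr_in assms by auto
qed simp

lemma card_edge_Diff_le:
  assumes "A \<in> \<F>" "x \<in> A \<inter> X" "y \<in> A \<inter> X" "x \<noteq> y"
  shows "card (A - X) \<le> k - 2"
proof -
  have "card (A - X) \<le> card (A - {x, y})"
    using assms finite_edge by (intro card_mono) auto
  also have "\<dots> = k - 2"
    using assms card_edge[OF assms(1)] by (subst card_Diff_subset) auto
  finally show ?thesis .
qed

text \<open>The consecutive pairs of the path are expanded greedily, one after the other. The
  closing edge \<open>A0\<close> is given in advance because its two path vertices may be available
  only through a triple or a rich pair; the later expansions then avoid it.\<close>

lemma cycle_of_path:
  assumes p: "distinct p" "length p = l" "successively (\<lambda>x y. flexible {x, y}) p"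
    and A0: "A0 \<in> \<F>" "A0 \<inter> set p = {hd p, last p}"
  shows False
proof -
  have "p \<noteq> []" using p(2) l3 by auto
  hence hdl: "hd p = p ! 0" "last p = p ! (l - 1)"
    using p(2) by (auto simp: hd_conv_nth last_conv_nth)
  have flex: "flexible {p ! i, p ! Suc i}" if "Suc i < l" for i
    using p(3) that p(2) by (simp add: successively_conv_nth)
  have ne: "p ! i \<noteq> p ! j" if "i < l" "j < l" "i \<noteq> j" for i j
    using p(1,2) that by (simp add: nth_eq_iff_index_eq)
  have A0c: "card (A0 - set p) \<le> k - 2"
    using card_edge_Diff_le[OF A0(1), of "hd p" "set p" "last p"] A0(2) ne[of 0 "l-1"] l3
    unfolding hdl by auto
  have "\<exists>E. (\<forall>i<j. E i \<in> \<F> \<and> E i \<inter> set p = {p ! i, p ! Suc i} \<and> (E i - set p) \<inter> A0 = {})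
    \<and> (\<forall>i<j. \<forall>i'<j. i \<noteq> i' \<longrightarrow> (E i - set p) \<inter> (E i' - set p) = {})" if "j \<le> l - 1" for j
    using that
  proof (induction j)
    case 0
    show ?case by simp
  next
    case (Suc j)
    then obtain E where E: "\<And>i. i < j \<Longrightarrow> E i \<in> \<F>" "\<And>i. i < j \<Longrightarrow> E i \<inter> set p = {p ! i, p ! Suc i}"
       "\<And>i. i < j \<Longrightarrow> (E i - set p) \<inter> A0 = {}"
       "\<And>i i'. i < j \<Longrightarrow> i' < j \<Longrightarrow> i \<noteq> i' \<Longrightarrow> (E i - set p) \<inter> (E i' - set p) = {}"
      by (metis Suc_leD)
    \<comment> \<open>Everything the next edge must avoid. The path has \<open>l\<close> vertices,
      and \<open>A0\<close> and each earlier edge add at most \<open>k - 2\<close> more, since each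
      already has two vertices on the path; the total stays below \<open>k * l\<close>.\<close>
    define U where "U = set p \<union> (A0 - set p) \<union> (\<Union>i<j. E i - set p)"
    have "card (\<Union>i<j. E i - set p) \<le> (\<Sum>i<j. card (E i - set p))"
      by (rule card_UN_le) simp
    also have "\<dots> \<le> (\<Sum>i<j. k - 2)"
    proof (rule sum_mono)
      fix i assume "i \<in> {..<j}"
      hence i: "i < j" by simp
      show "card (E i - set p) \<le> k - 2"
        using E(2)[OF i] ne[of i "Suc i"] i Suc.prems
        by (intro card_edge_Diff_le[OF E(1)[OF i], of "p ! i" _ "p ! Suc i"]) auto
    qed
    finally have UE: "card (\<Union>i<j. E i - set p) \<le> j * (k - 2)" by simp
    have "card U \<le> card (set p) + card (A0 - set p) + card (\<Union>i<j. E i - set p)"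
      unfolding U_def by (meson add_le_mono card_Un_le le_refl order_trans)
    also have "\<dots> \<le> l + (k - 2) + j * (k - 2)"
      using UE A0c p(1,2) by (simp add: distinct_card)
    also have "\<dots> \<le> l + (l - 1) * (k - 2)"
      using mult_le_mono1[OF Suc.prems, of "k - 2"] by simp
    also have "\<dots> < k * l"
    proof -
      obtain k' l' where "k = k' + 4" "l = l' + 3" using k4 l3 by (metis le_iff_add add.commute)
      thus ?thesis by (simp add: algebra_simps)
    qed
    finally have cU: "card U < k * l" .
    have "finite U" unfolding U_def using A0 E(1) finite_edge by auto
    moreover have "flexible {p ! j, p ! Suc j}" using flex Suc.prems by simp
    ultimately obtain A where A: "A \<in> \<F>" "{p ! j, p ! Suc j} \<subseteq> A" "A \<inter> U \<subseteq> {p ! j, p ! Suc j}"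
      using cU flexibleE by metis
    have pj: "p ! j \<in> set p" "p ! Suc j \<in> set p" using p(2) Suc.prems by auto
    show ?case
    proof (intro exI[of _ "E(j := A)"] conjI allI impI)
      fix i assume "i < Suc j"
      show "(E(j := A)) i \<in> \<F>" using A E(1) \<open>i < Suc j\<close> by (auto simp: less_Suc_eq)
      show "(E(j := A)) i \<inter> set p = {p ! i, p ! Suc i}"
        using A E(2) \<open>i < Suc j\<close> pj unfolding U_def by (auto simp: less_Suc_eq)
      show "((E(j := A)) i - set p) \<inter> A0 = {}"
        using A E(3) \<open>i < Suc j\<close> pj unfolding U_def by (fastforce simp: less_Suc_eq)
    next
      fix i i' assume ii: "i < Suc j" "i' < Suc j" "i \<noteq> i'"
      have "(A - set p) \<inter> (E q - set p) = {}" if "q < j" for q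
        using A that pj unfolding U_def by blast
      moreover have "(E q - set p) \<inter> (A - set p) = {}" if "q < j" for q
        using calculation[OF that] by blast
      ultimately show "((E(j := A)) i - set p) \<inter> ((E(j := A)) i' - set p) = {}"
        using E(4)[of i i'] ii by (cases "i = j"; cases "i' = j") (simp_all add: less_Suc_eq)
    qed
  qed
  from this[of "l - 1"] obtain E where E: "\<And>i. i < l - 1 \<Longrightarrow> E i \<in> \<F>"
    "\<And>i. i < l - 1 \<Longrightarrow> E i \<inter> set p = {p ! i, p ! Suc i}"
    "\<And>i. i < l - 1 \<Longrightarrow> (E i - set p) \<inter> A0 = {}"
    "\<And>i i'. i < l - 1 \<Longrightarrow> i' < l - 1 \<Longrightarrow> i \<noteq> i' \<Longrightarrow> (E i - set p) \<inter> (E i' - set p) = {}"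
    by (metis order_refl)
  define E' where "E' = E(l - 1 := A0)"
  have ltl: "i < l - 1 \<or> i = l - 1" if "i < l" for i using that by linarith
  have img: "(!) p ` {0..<l} = set p" using p(2) by (auto simp: set_conv_nth)
  have mem: "E' i \<in> \<F>" if "i < l" for i
    using E(1) A0(1) ltl[OF that] unfolding E'_def by auto
  have "linear_cycle k l E' ((!) p)"
    unfolding linear_cycle_def img
  proof (intro conjI allI impI)
    show "inj_on ((!) p) {0..<l}" using p(1,2) by (simp add: inj_on_nth)
    fix i assume i: "i < l"
    show "finite (E' i)" "card (E' i) = k" using mem[OF i] finite_edge card_edge by auto
    show "E' i \<inter> set p = {p ! i, p ! (Suc i mod l)}"
      using ltl[OF i]
    proof
      assume "i < l - 1"
      thus ?thesis using E(2)[of i] unfolding E'_def by (simp add: mod_less)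
    next
      assume "i = l - 1"
      thus ?thesis using A0(2) l3 unfolding E'_def hdl by auto
    qed
  next
    fix i j assume "i < l" "j < l" "i \<noteq> j"
    thus "(E' i - set p) \<inter> (E' j - set p) = {}"
      using ltl[of i] ltl[of j] E(3)[of i] E(3)[of j] E(4)[of i j] unfolding E'_def by auto
  qed
  thus False using no_cycle mem unfolding contains_linear_cycle_def by blast
qed

section \<open>Growing paths from rich pairs, and peeling off members\<close>

definition rich :: "'a set set \<Rightarrow> 'a set \<Rightarrow> bool" where
  "rich \<G> e \<longleftrightarrow> (\<forall>U. finite U \<and> card U < k * l \<longrightarrow>
     (\<exists>A\<in>\<G>. e \<subseteq> A - {ctr A} \<and> A \<inter> U \<subseteq> e))"

lemma richE:
  assumes "rich \<G> e" "finite U" "card U < k * l"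
  obtains A where "A \<in> \<G>" "e \<subseteq> A - {ctr A}" "A \<inter> U \<subseteq> e"
  using assms unfolding rich_def by auto

lemma rich_flexible: "rich \<G> e \<Longrightarrow> \<G> \<subseteq> \<F> \<Longrightarrow> flexible e"
  unfolding flexible_def
proof (intro allI impI)
  fix U :: "'a set"
  assume e: "rich \<G> e" "\<G> \<subseteq> \<F>" and U: "finite U \<and> card U < k * l"
  then obtain A where "A \<in> \<G>" "e \<subseteq> A - {ctr A}" "A \<inter> U \<subseteq> e"
    using richE[OF e(1), of U] by auto
  thus "\<exists>A\<in>\<F>. e \<subseteq> A \<and> A \<inter> U \<subseteq> e" using e(2) by auto
qed

lemma ctr_flexible:
  assumes "A \<in> \<F>" "x \<in> A - {ctr A}"
  shows "flexible {ctr A, x}" "flexible {x, ctr A}"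
proof -
  show "flexible {ctr A, x}" by (rule Ker_flexible[OF ctr_pair_Ker[OF assms]])
  moreover have "{x, ctr A} = {ctr A, x}" by auto
  ultimately show "flexible {x, ctr A}" by simp
qed

lemma l_less: "l < k * l"
proof -
  have "l < 4 * l" using l3 by simp
  also have "\<dots> \<le> k * l" using k4 by (rule mult_le_mono1)
  finally show ?thesis .
qed

text \<open>Richness places the centre of the completing member outside the pair, hence off the
  path. So a member \<open>B\<close> through the two ends of a path supplies two new vertices, its
  centre and one more, and the path grows by two while its end pair stays rich.\<close>

lemma rich_path:
  assumes G: "\<G> \<subseteq> \<F>" "\<G> \<noteq> {}"
    and cherry: "\<And>A x y z. A \<in> \<G> \<Longrightarrow> {x, y, z} \<subseteq> A - {ctr A} \<Longrightarrow> distinct [x, y, z] \<Longrightarrow>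
      rich \<G> {x, y} \<or> rich \<G> {y, z}"
    and m: "3 \<le> m" "m \<le> l"
  shows "\<exists>p. length p = m \<and> distinct p \<and> successively (\<lambda>x y. flexible {x, y}) p
    \<and> rich \<G> {hd p, last p}"
  using m
proof (induction m rule: less_induct)
  case (less m)
  obtain A where A: "A \<in> \<G>" using G by blast
  hence AF: "A \<in> \<F>" using G by blast
  have "card (A - {ctr A}) \<ge> 3" using card_edge[OF AF] ctr_in[OF AF] k4 by simp
  then obtain Y where "Y \<subseteq> A - {ctr A}" "card Y = 3" by (metis obtain_subset_with_card_n)
  then obtain u v w where uvw: "{u, v, w} \<subseteq> A - {ctr A}" "distinct [u, v, w]"
    by (auto simp: card_3_iff)
  \<comment> \<open>Any two of the three pairs in \<open>{u, v, w}\<close> are adjacent, so at most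
    one of them fails to be rich, and the other two share a vertex.\<close>
  have "\<exists>x y z. {x, y, z} \<subseteq> A - {ctr A} \<and> distinct [x, y, z] \<and> rich \<G> {x, y} \<and> rich \<G> {y, z}"
  proof -
    have "rich \<G> {u, v} \<or> rich \<G> {v, w}" "rich \<G> {v, w} \<or> rich \<G> {w, u}"
      "rich \<G> {w, u} \<or> rich \<G> {u, v}"
      using uvw cherry[OF A, of u v w] cherry[OF A, of v w u] cherry[OF A, of w u v] by auto
    then consider "rich \<G> {u, v} \<and> rich \<G> {v, w}" | "rich \<G> {v, w} \<and> rich \<G> {w, u}"
      | "rich \<G> {w, u} \<and> rich \<G> {u, v}" by blast
    thus ?thesis
    proof cases
      case 1
      thus ?thesis using uvw by blast
    next
      case 2
      thus ?thesis using uvw by (intro exI[of _ v] exI[of _ w] exI[of _ u]) auto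
    next
      case 3
      thus ?thesis using uvw by (intro exI[of _ w] exI[of _ u] exI[of _ v]) auto
    qed
  qed
  then obtain x y z where xyz: "{x, y, z} \<subseteq> A - {ctr A}" "distinct [x, y, z]"
    "rich \<G> {x, y}" "rich \<G> {y, z}" by blast
  have fl: "flexible {ctr A, q}" "flexible {q, ctr A}" if "q \<in> {x, y, z}" for q
    using ctr_flexible[OF AF] xyz(1) that by blast+
  \<comment> \<open>Growth is by two vertices, so each parity needs its own start: with the pair of
    ends added, these are a triangle and a 4-cycle through \<open>ctr A\<close>.\<close>
  consider "m = 3" | "m = 4" | "m \<ge> 5" using less.prems by linarith
  thus ?case
  proof cases
    case 1
    thus ?thesis using xyz fl by (intro exI[of _ "[x, ctr A, y]"]) auto
  next
    case 2
    thus ?thesis using xyz fl rich_flexible[OF xyz(4) G(1)]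
      by (intro exI[of _ "[y, z, ctr A, x]"]) (auto simp: insert_commute)
  next
    case 3
    hence "m - 2 < m" "3 \<le> m - 2" "m - 2 \<le> l" using less.prems by auto
    then obtain p where p: "length p = m - 2" "distinct p"
      "successively (\<lambda>x y. flexible {x, y}) p" "rich \<G> {hd p, last p}"
      using less.IH by blast
    have pn: "p \<noteq> []" using p(1) 3 by auto
    have "card (set p) \<le> l" using p(1,2) less.prems by (simp add: distinct_card)
    hence "card (set p) < k * l" using l_less by linarith
    then obtain B where B: "B \<in> \<G>" "{hd p, last p} \<subseteq> B - {ctr B}" "B \<inter> set p \<subseteq> {hd p, last p}"
      using richE[OF p(4)] by blast
    have BF: "B \<in> \<F>" using B G by blast
    have cp: "ctr B \<notin> set p" using B ctr_in[OF BF] by auto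
    have "card {ctr B, hd p, last p} < card B"
      using card_edge[OF BF] k4 by (simp add: card_insert_if)
    hence "\<not> B \<subseteq> {ctr B, hd p, last p}" by (metis card_mono finite.emptyI finite_insert leD)
    then obtain b where b: "b \<in> B" "b \<notin> {ctr B, hd p, last p}" by blast
    have bp: "b \<notin> set p" using B b by auto
    have hl: "hd p \<noteq> last p" using p(1,2) 3 pn
      by (simp add: hd_conv_nth last_conv_nth nth_eq_iff_index_eq)
    have fb: "flexible {ctr B, q}" "flexible {q, ctr B}" if "q \<in> {b, hd p, last p}" for q
      using ctr_flexible[OF BF] B(2) b that by blast+
    \<comment> \<open>Whichever pair is rich, its vertex of \<open>p\<close> stays an end. The path
      is prolonged through \<open>ctr B\<close> to \<open>b\<close> at the opposite end, which makes
      the rich pair the new end pair.\<close>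
    have "rich \<G> {hd p, b} \<or> rich \<G> {b, last p}"
      using B b hl by (intro cherry[OF B(1)]) auto
    thus ?thesis
    proof
      assume "rich \<G> {hd p, b}"
      thus ?thesis using p pn 3 bp cp b fb
        by (intro exI[of _ "p @ [ctr B, b]"]) (auto simp: successively_append_iff)
    next
      assume "rich \<G> {b, last p}"
      thus ?thesis using p pn 3 bp cp b fb
        by (intro exI[of _ "b # ctr B # p"]) (auto simp: successively_Cons)
    qed
  qed
qed

text \<open>If every cherry in every member had a rich pair, \<open>rich_path\<close> with
  \<open>m = l\<close> and one more member through its end pair would give a linear cycle. So some
  member has a cherry of two pairs that are not rich; it is removed and the rest is handled by
  induction. The set \<open>P e\<close> depends on the pair only and not on the member, as the
  double counting of light members requires.\<close>

lemma blocking_sets: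
  assumes "\<G> \<subseteq> \<F>"
  shows "\<exists>P. (\<forall>e. finite (P e) \<and> card (P e) < k * l \<and> P e \<inter> e = {}) \<and>
    (\<forall>A\<in>\<G>. \<exists>x y z. {x, y, z} \<subseteq> A - {ctr A} \<and> distinct [x, y, z] \<and>
       P {x, y} \<inter> A \<noteq> {} \<and> P {y, z} \<inter> A \<noteq> {})"
proof -
  have "finite \<G>" using assms finite_F finite_subset by blast
  thus ?thesis using assms
  proof (induction rule: finite_psubset_induct)
    case (psubset \<G>)
    show ?case
    proof (cases "\<G> = {}")
      case True
      thus ?thesis using k4 l3 by (intro exI[of _ "\<lambda>_. {}"]) auto
    next
      case False
      have "\<exists>A x y z. A \<in> \<G> \<and> {x, y, z} \<subseteq> A - {ctr A} \<and> distinct [x, y, z] \<and>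
        \<not> rich \<G> {x, y} \<and> \<not> rich \<G> {y, z}"
      proof (rule ccontr)
        assume "\<not> ?thesis"
        hence "\<exists>p. length p = l \<and> distinct p \<and> successively (\<lambda>x y. flexible {x, y}) p
          \<and> rich \<G> {hd p, last p}"
          using l3 by (intro rich_path[OF psubset.prems False]) blast+
        then obtain p where p: "length p = l" "distinct p" "successively (\<lambda>x y. flexible {x, y}) p"
          "rich \<G> {hd p, last p}" by blast
        have "card (set p) < k * l" using p(1,2) l_less by (simp add: distinct_card)
        then obtain B where B: "B \<in> \<G>" "{hd p, last p} \<subseteq> B - {ctr B}" "B \<inter> set p \<subseteq> {hd p, last p}"
          using richE[OF p(4)] by blast
        have "p \<noteq> []" using p(1) l3 by auto
        hence "B \<inter> set p = {hd p, last p}" using B by auto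
        thus False using cycle_of_path[OF p(2,1,3)] B(1) psubset.prems by blast
      qed
      then obtain A x y z where A: "A \<in> \<G>" "{x, y, z} \<subseteq> A - {ctr A}" "distinct [x, y, z]"
        "\<not> rich \<G> {x, y}" "\<not> rich \<G> {y, z}" by blast
      have "\<G> - {A} \<subset> \<G>" "\<G> - {A} \<subseteq> \<F>" using A psubset.prems by auto
      from psubset.IH[OF this] obtain P where
        P: "\<And>e. finite (P e) \<and> card (P e) < k * l \<and> P e \<inter> e = {}"
        "\<And>B. B \<in> \<G> - {A} \<Longrightarrow> \<exists>x y z. {x, y, z} \<subseteq> B - {ctr B} \<and> distinct [x, y, z] \<and>
           P {x, y} \<inter> B \<noteq> {} \<and> P {y, z} \<inter> B \<noteq> {}" by metis
      have "\<forall>e. \<exists>U. \<not> rich \<G> e \<longrightarrow> finite U \<and> card U < k * l \<and>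
          (\<forall>B\<in>\<G>. e \<subseteq> B - {ctr B} \<longrightarrow> \<not> B \<inter> U \<subseteq> e)"
        unfolding rich_def by meson
      then obtain U where U: "\<And>e. \<not> rich \<G> e \<Longrightarrow> finite (U e) \<and> card (U e) < k * l \<and>
          (\<forall>B\<in>\<G>. e \<subseteq> B - {ctr B} \<longrightarrow> \<not> B \<inter> U e \<subseteq> e)" by metis
      \<comment> \<open>Replacing \<open>P e\<close> by a witness against richness in the whole of
        \<open>\<G>\<close> is harmless: this witness meets every member of \<open>\<G>\<close> that
        has \<open>e\<close> off its centre, so it also serves the members treated by the induction
        hypothesis.\<close>
      define Q where "Q e = (if rich \<G> e then P e else U e - e)" for e
      have Q1: "finite (Q e) \<and> card (Q e) < k * l \<and> Q e \<inter> e = {}" for e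
        unfolding Q_def using P(1)[of e] U[of e]
        by (auto intro: le_less_trans[OF card_mono[of "U e" "U e - e"]])
      have Q2: "Q e \<inter> B \<noteq> {}" if "\<not> rich \<G> e" "B \<in> \<G>" "e \<subseteq> B - {ctr B}" for e B
        using U[OF that(1)] that unfolding Q_def by auto
      have Q3: "Q e \<inter> B \<noteq> {}" if "B \<in> \<G>" "e \<subseteq> B - {ctr B}" "P e \<inter> B \<noteq> {}" for e B
        using that Q2[of e B] unfolding Q_def by auto
      have "\<exists>x y z. {x, y, z} \<subseteq> B - {ctr B} \<and> distinct [x, y, z] \<and>
           Q {x, y} \<inter> B \<noteq> {} \<and> Q {y, z} \<inter> B \<noteq> {}" if B: "B \<in> \<G>" for B
      proof (cases "B = A")
        case True
        have "Q {x, y} \<inter> A \<noteq> {}" "Q {y, z} \<inter> A \<noteq> {}"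
          using A Q2[of "{x, y}" A] Q2[of "{y, z}" A] by auto
        thus ?thesis using True A by blast
      next
        case False
        then obtain x y z where w: "{x, y, z} \<subseteq> B - {ctr B}" "distinct [x, y, z]"
           "P {x, y} \<inter> B \<noteq> {}" "P {y, z} \<inter> B \<noteq> {}" using P(2)[of B] B by blast
        have "Q {x, y} \<inter> B \<noteq> {}" "Q {y, z} \<inter> B \<noteq> {}" using w Q3[OF B, of "{x, y}"] Q3[OF B, of "{y, z}"] by auto
        thus ?thesis using w by blast
      qed
      thus ?thesis using Q1 by blast
    qed
  qed
qed

section \<open>Common kernel neighbours and link pairs\<close>

definition nbr :: "'a \<Rightarrow> 'a set" where
  "nbr a = {x \<in> V. {a, x} \<in> Ker2 (k * l) \<F>}"

definition half_length :: nat where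
  "half_length = (l - 1) div 2"

lemma half_length_pos: "1 \<le> half_length"
  unfolding half_length_def using l3 by linarith

lemma finite_nbr: "finite (nbr a)"
  unfolding nbr_def using finite_V by simp

lemma not_in_nbr: "a \<notin> nbr a"
  unfolding nbr_def Ker2_def by simp

lemma nbr_flexible:
  assumes "x \<in> nbr a"
  shows "flexible {a, x}" "flexible {x, a}"
proof -
  show "flexible {a, x}" using assms Ker_flexible unfolding nbr_def Ker2_def by simp
  moreover have "{x, a} = {a, x}" by auto
  ultimately show "flexible {x, a}" by simp
qed

lemma edge_sub_nbr:
  assumes "A \<in> \<F>"
  shows "A - {ctr A} \<subseteq> nbr (ctr A)"
proof
  fix x assume x: "x \<in> A - {ctr A}"
  hence "card {ctr A, x} = 2" by auto
  thus "x \<in> nbr (ctr A)"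
    using ctr_pair_Ker[OF assms x] edge_sub[OF assms] x unfolding nbr_def Ker2_def by auto
qed

text \<open>The path alternates between \<open>j + 1\<close> vertices of \<open>B\<close> and
  \<open>j\<close> of \<open>A\<close>. After its first two vertices \<open>x\<close> and
  \<open>a\<close> are deleted from the two sides, the hypotheses persist with \<open>j\<close>
  lowered by one, which is why the sides vary in the induction.\<close>

lemma alternating_path:
  assumes "finite A" "finite B" "A \<inter> B = {}" "\<And>a. a \<in> A \<Longrightarrow> B \<subseteq> nbr a"
    "x \<in> B" "y \<in> B" "x \<noteq> y" "1 \<le> j" "j \<le> card A" "j < card B"
  shows "\<exists>p. length p = 2 * j + 1 \<and> distinct p \<and> set p \<subseteq> A \<union> B \<and> hd p = x \<and> last p = y
    \<and> successively (\<lambda>x y. flexible {x, y}) p"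
  using assms
proof (induction j arbitrary: A B x)
  case 0
  thus ?case by simp
next
  case (Suc j)
  obtain a where a: "a \<in> A" using Suc.prems by fastforce
  have ax: "a \<noteq> x" "a \<noteq> y" using a Suc.prems by auto
  have fl: "flexible {a, b}" "flexible {b, a}" if "b \<in> B" for b
    using nbr_flexible Suc.prems(4)[OF a] that by auto
  show ?case
  proof (cases "j = 0")
    case True
    thus ?thesis using a ax fl Suc.prems by (intro exI[of _ "[x, a, y]"]) auto
  next
    case False
    have "card {x, y} < card B" using False Suc.prems by (simp add: card_insert_if)
    hence "\<not> B \<subseteq> {x, y}" by (metis card_mono finite.emptyI finite_insert leD)
    then obtain b where b: "b \<in> B" "b \<noteq> x" "b \<noteq> y" by blast
    have "\<exists>p. length p = 2 * j + 1 \<and> distinct p \<and> set p \<subseteq> (A - {a}) \<union> (B - {x}) \<and> hd p = b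
       \<and> last p = y \<and> successively (\<lambda>x y. flexible {x, y}) p"
    proof (rule Suc.IH)
      show "(A - {a}) \<inter> (B - {x}) = {}" using Suc.prems(3) by auto
      show "\<And>a'. a' \<in> A - {a} \<Longrightarrow> B - {x} \<subseteq> nbr a'" using Suc.prems(4) by blast
    qed (use Suc.prems a b False in auto)
    then obtain p where p: "length p = 2 * j + 1" "distinct p" "set p \<subseteq> (A - {a}) \<union> (B - {x})"
      "hd p = b" "last p = y" "successively (\<lambda>x y. flexible {x, y}) p" by blast
    have pn: "p \<noteq> []" using p(1) by auto
    have "a \<notin> set p" "x \<notin> set p" using p(3) a Suc.prems(3,5) by auto
    thus ?thesis using p pn a ax fl[of x] fl[of b] b(1) Suc.prems(5)
      by (intro exI[of _ "x # a # p"]) (auto simp: successively_Cons)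
  qed
qed

text \<open>An alternating path from \<open>x\<close> to \<open>y\<close> that avoids the centre
  \<open>c\<close> of \<open>E\<close> has \<open>2 * half_length + 1\<close> vertices. For odd
  \<open>l\<close> this is already \<open>l\<close>, and a completion of the triple
  \<open>{c, x, y}\<close> closes it with \<open>c\<close> off the cycle. For even \<open>l\<close>
  one vertex is missing: \<open>c\<close> is appended after \<open>y\<close>, and a completion of
  \<open>{c, x}\<close> closes the cycle.\<close>

lemma no_noncentral_pair_in_common_nbr:
  assumes A: "finite A" "card A = half_length + 1" "\<And>a. a \<in> A \<Longrightarrow> B \<subseteq> nbr a"
    and B: "finite B" "half_length < card B"
    and E: "E \<in> \<F>" "ctr E \<in> A" and xy: "x \<in> E \<inter> B" "y \<in> E \<inter> B" "x \<noteq> y"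
  shows False
proof -
  let ?c = "ctr E"
  have AB: "A \<inter> B = {}" using A(3) not_in_nbr by blast
  have "\<exists>p. length p = 2 * half_length + 1 \<and> distinct p \<and> set p \<subseteq> (A - {?c}) \<union> B \<and> hd p = x
    \<and> last p = y \<and> successively (\<lambda>x y. flexible {x, y}) p"
  proof (rule alternating_path)
    show "(A - {?c}) \<inter> B = {}" using AB by blast
    show "\<And>a. a \<in> A - {?c} \<Longrightarrow> B \<subseteq> nbr a" using A(3) by blast
  qed (use A B E xy half_length_pos in auto)
  then obtain p where p: "length p = 2 * half_length + 1" "distinct p" "set p \<subseteq> (A - {?c}) \<union> B"
    "hd p = x" "last p = y" "successively (\<lambda>x y. flexible {x, y}) p" by blast
  have pn: "p \<noteq> []" using p(1) by auto
  hence xyp: "x \<in> set p" "y \<in> set p" using p(4,5) by auto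
  have cp: "?c \<notin> set p" using p(3) E(2) AB by blast
  have "l = 2 * half_length + 1 \<or> l = 2 * half_length + 2"
    unfolding half_length_def using l3 by presburger
  thus False
  proof
    assume l: "l = 2 * half_length + 1"
    have "card (set p) < k * l" using p(1,2) l l_less by (simp add: distinct_card)
    moreover have "flexible {?c, x, y}" using ctr_triple_flexible[OF E(1)] xy by auto
    ultimately obtain A0 where A0: "A0 \<in> \<F>" "{?c, x, y} \<subseteq> A0" "A0 \<inter> set p \<subseteq> {?c, x, y}"
      using flexibleE[of "{?c, x, y}" "set p"] by auto
    hence "A0 \<inter> set p = {hd p, last p}" using xyp cp p(4,5) by auto
    thus False using cycle_of_path[OF p(2) _ p(6) A0(1)] p(1) l by simp
  next
    assume l: "l = 2 * half_length + 2"
    let ?q = "p @ [?c]"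
    have q: "distinct ?q" "length ?q = l" using p(1,2) cp l by auto
    have fl: "flexible {?c, x}" "flexible {y, ?c}"
      using nbr_flexible[of _ ?c] A(3)[OF E(2)] xy by auto
    have sq: "successively (\<lambda>x y. flexible {x, y}) ?q"
      using p(5,6) fl(2) pn by (simp add: successively_append_iff)
    have "card (set ?q) < k * l" using q l_less distinct_card[OF q(1)] by simp
    then obtain A0 where A0: "A0 \<in> \<F>" "{?c, x} \<subseteq> A0" "A0 \<inter> set ?q \<subseteq> {?c, x}"
      using flexibleE[OF fl(1), of "set ?q"] by auto
    hence "A0 \<inter> set ?q = {hd ?q, last ?q}" using xyp p(4) pn by auto
    thus False using cycle_of_path[OF q sq A0(1)] by simp
  qed
qed

text \<open>This is the set \<open>R c\<close> of the outline: the pairs covered by the links of the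
  members centred at \<open>c\<close>.\<close>

definition link_pairs :: "'a \<Rightarrow> 'a set set" where
  "link_pairs c = {e. card e = 2 \<and> (\<exists>A\<in>\<F>. ctr A = c \<and> e \<subseteq> A - {c})}"

lemma link_pairs_sub_nbr: "e \<in> link_pairs c \<Longrightarrow> e \<subseteq> nbr c"
  unfolding link_pairs_def using edge_sub_nbr by fastforce

lemma nbr_sub: "nbr c \<subseteq> V"
  unfolding nbr_def by auto

lemma link_pairs_sub: "link_pairs c \<subseteq> {e. e \<subseteq> V \<and> card e = 2}"
  using link_pairs_sub_nbr nbr_sub unfolding link_pairs_def by blast

lemma finite_pairs: "finite {e. e \<subseteq> V \<and> card e = 2}"
  using finite_V by simp

lemma finite_link_pairs: "finite (link_pairs c)"
  using finite_subset[OF link_pairs_sub finite_pairs] .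

text \<open>Every common link pair lies in the common neighbourhood \<open>B\<close>. If
  \<open>B\<close> has more than \<open>half_length\<close> vertices, such a pair is excluded by the
  previous cycle argument; otherwise \<open>B\<close> has at most \<open>2 ^ half_length\<close>
  subsets.\<close>

lemma card_common_link_pairs:
  assumes "finite A" "card A = half_length + 1"
  shows "card (\<Inter>c\<in>A. link_pairs c) \<le> 2 ^ half_length"
proof -
  define B where "B = (\<Inter>c\<in>A. nbr c)"
  have "A \<noteq> {}" using assms by auto
  then obtain c where c: "c \<in> A" by blast
  have finB: "finite B" unfolding B_def using c finite_nbr by (meson INF_lower finite_subset)
  have sub: "e \<subseteq> B" if "e \<in> (\<Inter>c\<in>A. link_pairs c)" for e
    unfolding B_def using that link_pairs_sub_nbr by blast
  show ?thesis
  proof (cases "half_length < card B")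
    case True
    have "(\<Inter>c\<in>A. link_pairs c) = {}"
    proof (rule ccontr)
      assume "\<not> ?thesis"
      then obtain e where e: "e \<in> (\<Inter>c\<in>A. link_pairs c)" by blast
      hence "e \<in> link_pairs c" using c by blast
      then obtain E where E: "card e = 2" "E \<in> \<F>" "ctr E = c" "e \<subseteq> E - {c}"
        unfolding link_pairs_def by blast
      obtain x y where xy: "e = {x, y}" "x \<noteq> y" using E(1) by (auto simp: card_2_iff)
      have "B \<subseteq> nbr a" if "a \<in> A" for a unfolding B_def using that by blast
      thus False
        using no_noncentral_pair_in_common_nbr[OF assms, of B E x y] finB True E c xy sub[OF e] by auto
    qed
    thus ?thesis by simp
  next
    case False
    have "card (\<Inter>c\<in>A. link_pairs c) \<le> card (Pow B)"
      using sub finB by (intro card_mono) auto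
    also have "\<dots> \<le> 2 ^ half_length" using False finB by (simp add: card_Pow power_increasing)
    finally show ?thesis .
  qed
qed

text \<open>Incidences between pairs and centres are counted from the side of the pairs. A pair in
  more than \<open>half_length\<close> link sets is common to some \<open>half_length + 1\<close>
  centres. There are at most \<open>2 ^ card H\<close> such choices, each with at most
  \<open>2 ^ half_length\<close> pairs, and each exceptional pair costs at most
  \<open>card H\<close> extra.\<close>

lemma sum_card_link_pairs:
  assumes "finite H"
  shows "(\<Sum>c\<in>H. card (link_pairs c)) \<le>
    half_length * (card V choose 2) + card H * (2 ^ card H * 2 ^ half_length)"
proof -
  let ?E = "{e. e \<subseteq> V \<and> card e = 2}"
  let ?m = "\<lambda>e. card {c \<in> H. e \<in> link_pairs c}"
  let ?X = "{e \<in> ?E. half_length < ?m e}"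
  have finE: "finite ?E" by (rule finite_pairs)
  have eq: "{e \<in> ?E. e \<in> link_pairs c} = link_pairs c" for c using link_pairs_sub[of c] by blast
  have "(\<Sum>c\<in>H. card {e \<in> ?E. e \<in> link_pairs c}) = (\<Sum>e\<in>?E. ?m e)"
    using sum_multicount_gen[OF assms finE, of "\<lambda>c e. e \<in> link_pairs c" ?m] by simp
  hence "(\<Sum>c\<in>H. card (link_pairs c)) = (\<Sum>e\<in>?E. ?m e)" unfolding eq .
  also have "\<dots> \<le> (\<Sum>e\<in>?E. half_length + (if half_length < ?m e then card H else 0))"
  proof (rule sum_mono)
    fix e
    have "?m e \<le> card H" using assms by (intro card_mono) auto
    thus "?m e \<le> half_length + (if half_length < ?m e then card H else 0)" by auto
  qed
  also have "\<dots> = half_length * card ?E + card H * card ?X"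
    using finE by (simp add: sum.distrib sum.If_cases Int_def mult.commute)
  also have "card ?E = card V choose 2" using n_subsets[OF finite_V] by simp
  also have "card ?X \<le> 2 ^ card H * 2 ^ half_length"
  proof -
    let ?S = "{A. A \<subseteq> H \<and> card A = half_length + 1}"
    have "finite ?S" using assms by simp
    have "?X \<subseteq> (\<Union>A\<in>?S. \<Inter>c\<in>A. link_pairs c)"
    proof
      fix e assume "e \<in> ?X"
      hence "half_length + 1 \<le> card {c \<in> H. e \<in> link_pairs c}" by simp
      then obtain A where "A \<subseteq> {c \<in> H. e \<in> link_pairs c}" "card A = half_length + 1"
        by (metis obtain_subset_with_card_n)
      thus "e \<in> (\<Union>A\<in>?S. \<Inter>c\<in>A. link_pairs c)" by blast
    qed
    moreover have "(\<Inter>c\<in>A. link_pairs c) \<subseteq> ?E" if "A \<in> ?S" for A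
    proof -
      have "A \<noteq> {}" using that by auto
      thus ?thesis using link_pairs_sub by blast
    qed
    hence "finite (\<Union>A\<in>?S. \<Inter>c\<in>A. link_pairs c)"
      using finite_subset[OF _ finE] by (metis (no_types, lifting) UN_least)
    ultimately have "card ?X \<le> card (\<Union>A\<in>?S. \<Inter>c\<in>A. link_pairs c)" by (simp add: card_mono)
    also have "\<dots> \<le> (\<Sum>A\<in>?S. card (\<Inter>c\<in>A. link_pairs c))" by (rule card_UN_le[OF \<open>finite ?S\<close>])
    also have "\<dots> \<le> (\<Sum>A\<in>?S. 2 ^ half_length)"
    proof (rule sum_mono)
      fix A assume "A \<in> ?S"
      thus "card (\<Inter>c\<in>A. link_pairs c) \<le> 2 ^ half_length"
        using assms finite_subset by (intro card_common_link_pairs) auto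
    qed
    also have "\<dots> = card ?S * 2 ^ half_length" by simp
    also have "card ?S \<le> card (Pow H)" using assms by (intro card_mono) auto
    finally show ?thesis using assms by (simp add: card_Pow)
  qed
  finally show ?thesis by simp
qed

section \<open>Counting members by their centres\<close>

lemma card_edges_containing:
  assumes "finite D" "card D \<le> k"
  shows "card {A \<in> \<F>. D \<subseteq> A} \<le> card V ^ (k - card D)"
proof -
  let ?X = "{X. X \<subseteq> V \<and> card X = k - card D}"
  have "inj_on (\<lambda>A. A - D) {A \<in> \<F>. D \<subseteq> A}" by (rule inj_onI) blast
  moreover have "(\<lambda>A. A - D) ` {A \<in> \<F>. D \<subseteq> A} \<subseteq> ?X"
    using edge_sub card_edge assms by (auto simp: card_Diff_subset)
  moreover have "finite ?X" using finite_V by simp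
  ultimately have "card {A \<in> \<F>. D \<subseteq> A} \<le> card ?X" by (rule card_inj_on_le)
  also have "\<dots> = card V choose (k - card D)" by (rule n_subsets[OF finite_V])
  also have "\<dots> \<le> card V ^ (k - card D)"
    by (cases "k - card D \<le> card V") (auto simp: binomial_le_pow binomial_eq_0)
  finally show ?thesis .
qed

text \<open>Each member centred at \<open>c\<close> contains \<open>(k - 1) choose 2\<close> link
  pairs, and each link pair extends only by \<open>k - 3\<close> further kernel neighbours of
  \<open>c\<close>. Of the gain from a small neighbourhood only one factor \<open>d / n\<close> is
  kept. The fractions are multiplied out to stay within the natural numbers.\<close>

lemma card_star_le:
  assumes "k - 1 \<le> card V"
  shows "card {A \<in> \<F>. ctr A = c} * card V * (card V choose 2)
    \<le> card (link_pairs c) * card (nbr c) * (card V choose (k - 1))"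
proof -
  let ?S = "{A \<in> \<F>. ctr A = c}" and ?R = "link_pairs c" and ?n = "card V" and ?d = "card (nbr c)"
  have finS: "finite ?S" using finite_F by simp
  have dn: "?d \<le> ?n" by (rule card_mono[OF finite_V nbr_sub])
  have "card {e \<in> ?R. e \<subseteq> A} = (k - 1) choose 2" if A: "A \<in> ?S" for A
  proof -
    have "{e \<in> ?R. e \<subseteq> A} = {e. e \<subseteq> A - {c} \<and> card e = 2}"
      using A unfolding link_pairs_def by auto
    moreover have "card (A - {c}) = k - 1" "finite (A - {c})"
      using A ctr_in card_edge finite_edge by auto
    ultimately show ?thesis using n_subsets[of "A - {c}" 2] by simp
  qed
  hence "card ?S * ((k - 1) choose 2) = (\<Sum>A\<in>?S. card {e \<in> ?R. e \<subseteq> A})" by simp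
  also have "\<dots> = (\<Sum>e\<in>?R. card {A \<in> ?S. e \<subseteq> A})"
    using sum_multicount_gen[OF finS finite_link_pairs[of c], of "\<lambda>A e. e \<subseteq> A"] by simp
  also have "\<dots> \<le> (\<Sum>e\<in>?R. (?d - 2) choose (k - 3))"
  proof (rule sum_mono)
    fix e assume e: "e \<in> ?R"
    let ?X = "{X. X \<subseteq> nbr c - e \<and> card X = k - 3}"
    have ce: "c \<notin> e" "card e = 2" using e unfolding link_pairs_def by auto
    hence fe: "finite e" by (simp add: card_ge_0_finite)
    have "inj_on (\<lambda>A. A - insert c e) {A \<in> ?S. e \<subseteq> A}"
    proof (rule inj_onI)
      fix A B assume AB: "A \<in> {A \<in> ?S. e \<subseteq> A}" "B \<in> {A \<in> ?S. e \<subseteq> A}"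
        "A - insert c e = B - insert c e"
      have "insert c e \<subseteq> A" "insert c e \<subseteq> B" using AB ctr_in[of A] ctr_in[of B] by auto
      thus "A = B" using AB(3) by (metis Diff_partition)
    qed
    moreover have "(\<lambda>A. A - insert c e) ` {A \<in> ?S. e \<subseteq> A} \<subseteq> ?X"
    proof
      fix X assume "X \<in> (\<lambda>A. A - insert c e) ` {A \<in> ?S. e \<subseteq> A}"
      then obtain A where A: "X = A - insert c e" "A \<in> \<F>" "ctr A = c" "e \<subseteq> A" by auto
      have "card X = card A - card (insert c e)"
        unfolding A(1) using A ctr_in[OF A(2)] fe by (intro card_Diff_subset) auto
      hence "card X = k - 3" using ce fe card_edge[OF A(2)] by simp
      thus "X \<in> ?X" using A edge_sub_nbr[OF A(2)] by auto
    qed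
    moreover have "finite ?X" using finite_nbr by simp
    ultimately have "card {A \<in> ?S. e \<subseteq> A} \<le> card ?X" by (rule card_inj_on_le)
    also have "\<dots> = card (nbr c - e) choose (k - 3)" by (rule n_subsets) (use finite_nbr in auto)
    also have "card (nbr c - e) = ?d - 2"
      using link_pairs_sub_nbr[OF e] ce fe by (simp add: card_Diff_subset)
    finally show "card {A \<in> ?S. e \<subseteq> A} \<le> (?d - 2) choose (k - 3)" .
  qed
  finally have 1: "card ?S * ((k - 1) choose 2) \<le> card ?R * ((?d - 2) choose (k - 3))" by simp
  \<comment> \<open>For positive \<open>j\<close> and \<open>a <= b\<close>, the quotient of
    \<open>a choose j\<close> by \<open>b choose j\<close> is at most \<open>a / b\<close>; raising
    numerator and denominator by 2 keeps the bound because the quotient is at most 1. For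
    \<open>?d\<close> below 3 the left side vanishes.\<close>
  have 2: "((?d - 2) choose (k - 3)) * ?n \<le> ((?n - 2) choose (k - 3)) * ?d"
  proof (cases "3 \<le> ?d")
    case False
    hence "(?d - 2) choose (k - 3) = 0" using k4 by (intro binomial_eq_0) auto
    thus ?thesis by (simp only: mult_0)
  next
    case True
    define a b j where "a = ?d - 2" "b = ?n - 2" "j = k - 3"
    have ab: "a \<le> b" "1 \<le> a" "1 \<le> j" "?d = a + 2" "?n = b + 2"
      unfolding a_b_j_def using True dn k4 by auto
    have "j * (a choose j) * b = (a * b) * ((a - 1) choose (j - 1))"
      using times_binomial_minus1_eq[of j a] ab by simp
    also have "\<dots> \<le> (a * b) * ((b - 1) choose (j - 1))"
      using ab by (intro mult_le_mono2 binomial_right_mono) auto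
    also have "\<dots> = j * (b choose j) * a"
      using times_binomial_minus1_eq[of j b] ab by simp
    finally have "(a choose j) * b \<le> (b choose j) * a" using ab by simp
    moreover have "(a choose j) \<le> (b choose j)" using ab by (intro binomial_right_mono) auto
    ultimately show ?thesis using ab unfolding a_b_j_def[symmetric] by (simp add: algebra_simps)
  qed
  have 3: "(?n choose (k - 1)) * ((k - 1) choose 2) = (?n choose 2) * ((?n - 2) choose (k - 3))"
    using choose_mult[of 2 "k - 1" ?n] assms k4 by (simp add: numeral_3_eq_3 numeral_2_eq_2)
  have "((k - 1) choose 2) * (card ?S * ?n * (?n choose 2))
      = (card ?S * ((k - 1) choose 2)) * (?n * (?n choose 2))" by simp
  also have "\<dots> \<le> (card ?R * ((?d - 2) choose (k - 3))) * (?n * (?n choose 2))"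
    using 1 by (rule mult_le_mono1)
  also have "\<dots> = (((?d - 2) choose (k - 3)) * ?n) * (card ?R * (?n choose 2))" by simp
  also have "\<dots> \<le> (((?n - 2) choose (k - 3)) * ?d) * (card ?R * (?n choose 2))"
    using 2 by (rule mult_le_mono1)
  also have "\<dots> = ((?n choose 2) * ((?n - 2) choose (k - 3))) * (card ?R * ?d)" by simp
  also have "\<dots> = ((k - 1) choose 2) * (card ?R * ?d * (?n choose (k - 1)))"
    unfolding 3[symmetric] by simp
  finally show ?thesis using k4 by (simp add: zero_less_binomial)
qed

text \<open>The light members are covered by two classes, each a union of sets \<open>W D\<close>
  with \<open>card D = 4\<close>. Such a set has at most \<open>w\<close> members, so it suffices to
  choose the four vertices in at most \<open>s * \<eta> * n ^ 3\<close> ways for each class; and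
  \<open>n ^ 3 * w\<close> is \<open>n ^ (k - 1)\<close>.\<close>

lemma card_light_edges:
  fixes \<eta> :: real
  assumes \<eta>: "0 < \<eta>" "\<eta> \<le> 1"
  shows "real (card {A \<in> \<F>. real (card (link_pairs (ctr A))) < \<eta>\<^sup>2 * real (card V) ^ 2})
    \<le> 2 * real (k * l) * \<eta> * real (card V) ^ (k - 1)"
proof -
  define n w s where "n = real (card V)" and "w = n ^ (k - 4)" and "s = real (k * l)"
  have pos: "0 \<le> n" "0 \<le> w" "0 \<le> s" unfolding n_def w_def s_def by auto
  define L where "L = {c \<in> V. real (card (link_pairs c)) < \<eta>\<^sup>2 * n\<^sup>2}"
  obtain P where P: "\<And>e. finite (P e)" "\<And>e. card (P e) < k * l" "\<And>e. P e \<inter> e = {}"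
    and cherry: "\<And>A. A \<in> \<F> \<Longrightarrow> \<exists>x y z. {x, y, z} \<subseteq> A - {ctr A} \<and> distinct [x, y, z] \<and>
       P {x, y} \<inter> A \<noteq> {} \<and> P {y, z} \<inter> A \<noteq> {}"
    using blocking_sets[OF order_refl] by metis
  define W where "W D = {A \<in> \<F>. D \<subseteq> A}" for D
  have W4: "real (card (W D)) \<le> w" if "card D = 4" for D
  proof -
    have "finite D" using that by (simp add: card_ge_0_finite)
    hence "card (W D) \<le> card V ^ (k - 4)"
      using card_edges_containing[of D] that k4 unfolding W_def by simp
    thus ?thesis unfolding w_def n_def by (metis of_nat_le_iff of_nat_power)
  qed
  have finL: "finite L" unfolding L_def using finite_V by simp
  have cL: "real (card L) \<le> n"
    unfolding n_def L_def using finite_V by (simp add: card_mono)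
  define Dg where "Dg c y = {x \<in> V. x \<noteq> y \<and> c \<in> P {x, y}}" for c y
  have finD: "finite (Dg c y)" for c y unfolding Dg_def using finite_V by simp
  have D_ne: "c \<noteq> x" "c \<noteq> y" "x \<noteq> y" if "x \<in> Dg c y" for c x y
    using that P(3)[of "{x, y}"] unfolding Dg_def by auto
  \<comment> \<open>The sum counts triples in which \<open>c\<close> blocks \<open>{x, y}\<close>;
    every pair has fewer than \<open>k * l\<close> blocking vertices.\<close>
  have sumD: "(\<Sum>c\<in>V. \<Sum>y\<in>V. real (card (Dg c y))) \<le> s * n\<^sup>2"
  proof -
    have "(\<Sum>c\<in>V. \<Sum>y\<in>V. card (Dg c y)) = (\<Sum>y\<in>V. \<Sum>c\<in>V. card (Dg c y))"
      by (rule sum.swap)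
    also have "\<dots> = (\<Sum>y\<in>V. \<Sum>x\<in>V. card {c \<in> V. x \<noteq> y \<and> c \<in> P {x, y}})"
    proof (rule sum.cong[OF refl])
      fix y
      show "(\<Sum>c\<in>V. card (Dg c y)) = (\<Sum>x\<in>V. card {c \<in> V. x \<noteq> y \<and> c \<in> P {x, y}})"
        unfolding Dg_def
        using sum_multicount_gen[OF finite_V finite_V, of "\<lambda>c x. x \<noteq> y \<and> c \<in> P {x, y}"] by simp
    qed
    also have "\<dots> \<le> (\<Sum>y\<in>V. \<Sum>x\<in>V. k * l)"
    proof (intro sum_mono)
      fix x y
      have "card {c \<in> V. x \<noteq> y \<and> c \<in> P {x, y}} \<le> card (P {x, y})"
        using P(1) by (intro card_mono) auto
      thus "card {c \<in> V. x \<noteq> y \<and> c \<in> P {x, y}} \<le> k * l" using P(2)[of "{x, y}"] by linarith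
    qed
    also have "\<dots> = (k * l) * card V ^ 2" by (simp add: power2_eq_square)
    finally have "real (\<Sum>c\<in>V. \<Sum>y\<in>V. card (Dg c y)) \<le> real ((k * l) * card V ^ 2)"
      by (rule of_nat_mono)
    thus ?thesis unfolding s_def n_def by simp
  qed
  \<comment> \<open>\<open>TA\<close>: members in which a noncentral pair is blocked by a noncentral vertex. In all others the
    blocking vertex of the two pairs \<open>{x, y}\<close>, \<open>{y, z}\<close> is the centre \<open>c\<close>; those are collected in
    \<open>S c y\<close>. Few \<open>x\<close> such that \<open>c\<close> blocks \<open>{x, y}\<close> leave few choices for \<open>x, z\<close>; many occur for few
    \<open>(c, y)\<close> only, and then lightness of \<open>c\<close> bounds the choices of \<open>{x, z}\<close>.\<close>
  define TA where "TA = (\<Union>c\<in>L. \<Union>e\<in>link_pairs c. \<Union>u\<in>P e - insert c e. W (insert c (insert u e)))"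
  define S where "S c y = (if real (card (Dg c y)) \<le> \<eta> * n
      then \<Union>x\<in>Dg c y. \<Union>z\<in>Dg c y - {x}. W {c, y, x, z}
      else if c \<in> L then \<Union>e\<in>{e \<in> link_pairs c. y \<notin> e}. W (insert c (insert y e)) else {})" for c y
  have link: "c \<notin> e" "card e = 2" "finite e" if "e \<in> link_pairs c" for c e
    using that unfolding link_pairs_def by (auto simp: card_ge_0_finite)
  have "real (card TA) \<le> real (card L) * (\<eta>\<^sup>2 * n\<^sup>2 * (s * w))"
    unfolding TA_def
  proof (rule card_UN_le_mult[OF finL])
    fix c assume c: "c \<in> L"
    have "real (card (\<Union>u\<in>P e - insert c e. W (insert c (insert u e)))) \<le> s * w"
      if e: "e \<in> link_pairs c" for e
    proof -
      have "real (card (\<Union>u\<in>P e - insert c e. W (insert c (insert u e))))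
          \<le> real (card (P e - insert c e)) * w"
        using P(1) link[OF e] by (intro card_UN_le_mult W4) auto
      also have "card (P e - insert c e) \<le> card (P e)" using P(1) by (intro card_mono) auto
      hence "real (card (P e - insert c e)) \<le> s" using P(2)[of e] unfolding s_def by linarith
      finally show ?thesis using pos by (simp add: mult_right_mono)
    qed
    hence "real (card (\<Union>e\<in>link_pairs c. \<Union>u\<in>P e - insert c e. W (insert c (insert u e))))
        \<le> real (card (link_pairs c)) * (s * w)"
      by (intro card_UN_le_mult finite_link_pairs)
    also have "\<dots> \<le> \<eta>\<^sup>2 * n\<^sup>2 * (s * w)"
      using c pos unfolding L_def by (intro mult_right_mono) auto
    finally show "real (card (\<Union>e\<in>link_pairs c. \<Union>u\<in>P e - insert c e. W (insert c (insert u e))))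
        \<le> \<eta>\<^sup>2 * n\<^sup>2 * (s * w)" .
  qed
  also have "\<dots> \<le> n * (\<eta>\<^sup>2 * n\<^sup>2 * (s * w))" using cL pos by (intro mult_right_mono) auto
  also have "\<dots> = \<eta> * (\<eta> * (s * (n ^ 3 * w)))" by (simp add: power2_eq_square power3_eq_cube)
  also have "\<dots> \<le> \<eta> * (1 * (s * (n ^ 3 * w)))"
    using \<eta> pos by (intro mult_left_mono mult_right_mono) auto
  finally have TA: "real (card TA) \<le> s * \<eta> * (n ^ 3 * w)" by (simp add: mult_ac)
  \<comment> \<open>Both cases are brought to a bound linear in \<open>card (Dg c y)\<close>, so
    that \<open>sumD\<close> applies. If this degree is at most \<open>\<eta> * n\<close>, one of
    its two factors is replaced by \<open>\<eta> * n\<close>; if it is larger, lightness bounds the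
    link pairs by \<open>\<eta> * n * (\<eta> * n)\<close>, and one factor is replaced by the
    degree.\<close>
  have S1: "real (card (S c y)) \<le> real (card (Dg c y)) * (\<eta> * n * w)" for c y
  proof (cases "real (card (Dg c y)) \<le> \<eta> * n")
    case True
    have "real (card (\<Union>z\<in>Dg c y - {x}. W {c, y, x, z})) \<le> \<eta> * n * w" if x: "x \<in> Dg c y" for x
    proof -
      have "real (card (\<Union>z\<in>Dg c y - {x}. W {c, y, x, z})) \<le> real (card (Dg c y - {x})) * w"
      proof (intro card_UN_le_mult W4)
        fix z assume "z \<in> Dg c y - {x}"
        thus "card {c, y, x, z} = 4" using D_ne[of z c y] D_ne[OF x] by auto
      qed (use finD in auto)
      also have "card (Dg c y - {x}) \<le> card (Dg c y)" using finD by (intro card_mono) auto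
      hence "real (card (Dg c y - {x})) \<le> \<eta> * n" using True by linarith
      finally show ?thesis using pos by (simp add: mult_right_mono)
    qed
    thus ?thesis using True unfolding S_def by (auto intro!: card_UN_le_mult finD)
  next
    case False
    hence "Dg c y \<noteq> {}" using \<eta> pos by auto
    hence cy: "c \<noteq> y" using D_ne by blast
    show ?thesis
    proof (cases "c \<in> L")
      case True
      have "real (card (S c y)) \<le> real (card {e \<in> link_pairs c. y \<notin> e}) * w"
        unfolding S_def using False True
      proof (simp, intro card_UN_le_mult W4)
        fix e assume "e \<in> {e \<in> link_pairs c. y \<notin> e}"
        thus "card (insert c (insert y e)) = 4" using link[of e c] cy by auto
      qed (use finite_link_pairs in auto)
      also have "\<dots> \<le> real (card (link_pairs c)) * w"
        using pos finite_link_pairs by (intro mult_right_mono of_nat_mono card_mono) auto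
      also have "\<dots> \<le> (\<eta> * n) * (\<eta> * n) * w"
        using True pos unfolding L_def by (intro mult_right_mono) (auto simp: power2_eq_square mult_ac)
      also have "\<dots> \<le> real (card (Dg c y)) * (\<eta> * n) * w"
        using False pos \<eta> by (intro mult_right_mono) auto
      finally show ?thesis by (simp add: mult_ac)
    next
      case nL: False
      thus ?thesis using False pos \<eta> unfolding S_def by simp
    qed
  qed
  have "real (card (\<Union>c\<in>V. \<Union>y\<in>V. S c y)) \<le> (\<Sum>c\<in>V. \<Sum>y\<in>V. real (card (Dg c y)) * (\<eta> * n * w))"
    by (intro card_UN_le_sum finite_V S1)
  also have "\<dots> = (\<Sum>c\<in>V. \<Sum>y\<in>V. real (card (Dg c y))) * (\<eta> * n * w)"
    by (simp add: sum_distrib_right)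
  also have "\<dots> \<le> s * n\<^sup>2 * (\<eta> * n * w)"
    using sumD \<eta> pos by (intro mult_right_mono) auto
  finally have TB: "real (card (\<Union>c\<in>V. \<Union>y\<in>V. S c y)) \<le> s * \<eta> * (n ^ 3 * w)"
    by (simp add: power2_eq_square power3_eq_cube mult_ac)
  have "A \<in> TA \<union> (\<Union>c\<in>V. \<Union>y\<in>V. S c y)"
    if A: "A \<in> \<F>" "real (card (link_pairs (ctr A))) < \<eta>\<^sup>2 * n\<^sup>2" for A
  proof -
    let ?c = "ctr A"
    have cV: "?c \<in> V" using ctr_in[OF A(1)] edge_sub[OF A(1)] by blast
    hence cL': "?c \<in> L" using A(2) unfolding L_def by simp
    obtain x y z where xyz: "{x, y, z} \<subseteq> A - {?c}" "distinct [x, y, z]"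
       "P {x, y} \<inter> A \<noteq> {}" "P {y, z} \<inter> A \<noteq> {}" using cherry[OF A(1)] by metis
    have pair: "A \<in> TA \<or> ?c \<in> P e" if "e \<subseteq> A - {?c}" "card e = 2" "P e \<inter> A \<noteq> {}" for e
    proof -
      obtain u where u: "u \<in> P e" "u \<in> A" using \<open>P e \<inter> A \<noteq> {}\<close> by auto
      show ?thesis
      proof (cases "u = ?c")
        case False
        have "e \<in> link_pairs ?c" using that A(1) unfolding link_pairs_def by auto
        moreover have "u \<in> P e - insert ?c e" using u False P(3)[of e] by auto
        moreover have "A \<in> W (insert ?c (insert u e))"
          using that u A(1) ctr_in[OF A(1)] unfolding W_def by auto
        ultimately show ?thesis using cL' unfolding TA_def by blast
      qed (use u in simp)
    qed
    show ?thesis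
    proof (cases "A \<in> TA")
      case False
      have zy: "{z, y} = {y, z}" by auto
      have "?c \<in> P {x, y}" "?c \<in> P {y, z}"
        using pair[of "{x, y}"] pair[of "{y, z}"] False xyz by auto
      moreover have V: "x \<in> V" "y \<in> V" "z \<in> V" using xyz edge_sub[OF A(1)] by auto
      ultimately have D: "x \<in> Dg ?c y" "z \<in> Dg ?c y - {x}"
        using xyz(2) zy unfolding Dg_def by auto
      have "A \<in> S ?c y"
      proof (cases "real (card (Dg ?c y)) \<le> \<eta> * n")
        case True
        have "A \<in> W {?c, y, x, z}" using xyz A(1) ctr_in[OF A(1)] unfolding W_def by auto
        thus ?thesis using True D unfolding S_def by auto
      next
        case big: False
        have "{x, z} \<in> {e \<in> link_pairs ?c. y \<notin> e}"
          using xyz(1,2) A(1) unfolding link_pairs_def by auto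
        moreover have "A \<in> W (insert ?c (insert y {x, z}))"
          using xyz A(1) ctr_in[OF A(1)] unfolding W_def by auto
        ultimately show ?thesis using big cL' unfolding S_def by auto
      qed
      thus ?thesis using cV V by blast
    qed simp
  qed
  hence "{A \<in> \<F>. real (card (link_pairs (ctr A))) < \<eta>\<^sup>2 * n\<^sup>2} \<subseteq> TA \<union> (\<Union>c\<in>V. \<Union>y\<in>V. S c y)"
    by blast
  moreover have "TA \<union> (\<Union>c\<in>V. \<Union>y\<in>V. S c y) \<subseteq> \<F>"
    unfolding TA_def S_def W_def by (auto split: if_splits)
  ultimately have "card {A \<in> \<F>. real (card (link_pairs (ctr A))) < \<eta>\<^sup>2 * n\<^sup>2}
      \<le> card (TA \<union> (\<Union>c\<in>V. \<Union>y\<in>V. S c y))"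
    using finite_F finite_subset by (intro card_mono) blast+
  also have "\<dots> \<le> card TA + card (\<Union>c\<in>V. \<Union>y\<in>V. S c y)" by (rule card_Un_le)
  finally have "real (card {A \<in> \<F>. real (card (link_pairs (ctr A))) < \<eta>\<^sup>2 * n\<^sup>2})
      \<le> 2 * s * \<eta> * (n ^ 3 * w)" using TA TB by linarith
  also have "n ^ 3 * w = n ^ (k - 1)"
    unfolding w_def using k4 by (simp flip: power_add)
  finally show ?thesis unfolding n_def s_def .
qed

text \<open>Put \<open>x c\<close> for the density of the link pairs and \<open>y c\<close> for the
  relative kernel degree. Over the heavy centres the sum of \<open>x c\<close> is at most about
  \<open>half_length\<close>, while the lower bound on \<open>card \<F>\<close> forces the sum of
  \<open>x c * y c\<close> to be at least about the same. So almost all the weight \<open>x\<close>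
  sits where \<open>y\<close> is almost 1, and as \<open>x c <= 1\<close> this takes
  \<open>half_length\<close> centres.\<close>

lemma exists_full_stars:
  fixes \<alpha> \<eta> \<delta> q :: real and M :: nat
  assumes \<alpha>: "0 < \<alpha>" "\<alpha> \<le> 1" and \<eta>: "0 < \<eta>" "\<eta> \<le> 1" and \<delta>: "0 \<le> \<delta>"
    and q: "q = real (k - 1) ^ (k - 1)" "2 * real (k * l) * \<eta> * q \<le> \<alpha> / 6" "\<delta> * q \<le> \<alpha> / 6"
    and M: "real half_length + 1 \<le> real M * \<eta>\<^sup>2"
    and n: "k \<le> card V" "real (M * (2 ^ M * 2 ^ half_length)) \<le> \<alpha> / 6 * real (card V choose 2)"
    and F: "real half_length * real (card V choose (k - 1)) - \<delta> * real (card V) ^ (k - 1) \<le> real (card \<F>)"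
  shows "\<exists>S\<subseteq>V. card S = half_length \<and> (\<forall>a\<in>S. (1 - \<alpha>) * real (card V) \<le> real (card (nbr a)))"
proof -
  define n C P2 N where "n = real (card V)" and "C = real (M * (2 ^ M * 2 ^ half_length))"
    and "P2 = real (card V choose 2)" and "N = real (card V choose (k - 1))"
  have npos: "0 < n" "0 < P2" "0 < N" unfolding n_def P2_def N_def using n(1) k4 by auto
  have P2n: "P2 \<le> n\<^sup>2"
  proof -
    have "card V choose 2 \<le> card V ^ 2" using n(1) k4 by (intro binomial_le_pow) auto
    hence "real (card V choose 2) \<le> real (card V ^ 2)" by (rule of_nat_mono)
    thus ?thesis unfolding P2_def n_def by simp
  qed
  \<comment> \<open>The factor \<open>q\<close> converts errors of order \<open>n ^ (k - 1)\<close>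
    into multiples of \<open>N\<close>; the light members and the deficit \<open>\<delta>\<close>
    then cost at most \<open>\<alpha> / 6 * N\<close> each.\<close>
  have nN: "n ^ (k - 1) \<le> q * N"
  proof -
    have "(n / real (k - 1)) ^ (k - 1) \<le> N"
      unfolding n_def N_def using n(1) k4 by (intro binomial_ge_n_over_k_pow_k) auto
    thus ?thesis unfolding q(1) using k4 by (simp add: power_divide field_simps)
  qed
  let ?p = "\<lambda>c. real (card (link_pairs c))" and ?d = "\<lambda>c. real (card (nbr c))"
  define H where "H = {c \<in> V. \<eta>\<^sup>2 * n\<^sup>2 \<le> ?p c}"
  have finH: "finite H" unfolding H_def using finite_V by simp
  have sum_p: "(\<Sum>c\<in>X. ?p c) \<le> real half_length * P2 + C" if "finite X" "card X \<le> M" for X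
  proof -
    have "(\<Sum>c\<in>X. card (link_pairs c)) \<le>
        half_length * (card V choose 2) + card X * (2 ^ card X * 2 ^ half_length)"
      by (rule sum_card_link_pairs[OF that(1)])
    also have "card X * (2 ^ card X * 2 ^ half_length) \<le> M * (2 ^ M * 2 ^ half_length)"
      using that(2) by (intro mult_le_mono power_increasing) auto
    finally have "(\<Sum>c\<in>X. card (link_pairs c)) \<le>
        half_length * (card V choose 2) + M * (2 ^ M * 2 ^ half_length)" by simp
    hence "real (\<Sum>c\<in>X. card (link_pairs c)) \<le>
        real (half_length * (card V choose 2) + M * (2 ^ M * 2 ^ half_length))"
      by (rule of_nat_mono)
    thus ?thesis unfolding P2_def C_def by simp
  qed
  \<comment> \<open>The error term of \<open>sum_card_link_pairs\<close> grows with the number of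
    centres, so it is applied to exactly \<open>M\<close> heavy centres, where it is the constant
    \<open>C\<close>. Their link pairs would number at least
    \<open>(half_length + 1) * n\<^sup>2\<close>, which is too many.\<close>
  have "card H < M"
  proof (rule ccontr)
    assume "\<not> card H < M"
    then obtain X where X: "X \<subseteq> H" "card X = M" by (metis not_less obtain_subset_with_card_n)
    have "(real half_length + 1) * n\<^sup>2 \<le> real M * \<eta>\<^sup>2 * n\<^sup>2" using M by (intro mult_right_mono) auto
    also have "\<dots> = (\<Sum>c\<in>X. \<eta>\<^sup>2 * n\<^sup>2)" using X(2) by simp
    also have "\<dots> \<le> (\<Sum>c\<in>X. ?p c)" using X(1) unfolding H_def by (intro sum_mono) auto
    also have "\<dots> \<le> real half_length * P2 + C" using X finH finite_subset by (intro sum_p) auto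
    also have "\<dots> \<le> real half_length * n\<^sup>2 + C" using P2n by (simp add: mult_left_mono)
    finally have "n\<^sup>2 \<le> C" by (simp add: algebra_simps)
    also have "C \<le> \<alpha> / 6 * P2" using n(2) unfolding C_def P2_def .
    also have "\<dots> \<le> 1 / 6 * n\<^sup>2" using \<alpha> P2n npos by (intro mult_mono) auto
    finally show False using npos by simp
  qed
  hence sp: "(\<Sum>c\<in>H. ?p c) \<le> (real half_length + \<alpha> / 6) * P2"
    using sum_p[OF finH] n(2) unfolding C_def P2_def[symmetric] by (simp add: algebra_simps)
  define x y where "x c = ?p c / P2" and "y c = ?d c / n" for c
  have x0: "0 \<le> x c" for c unfolding x_def using npos by simp
  have x1: "x c \<le> 1" for c
  proof -
    have "card (link_pairs c) \<le> card {e. e \<subseteq> V \<and> card e = 2}"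
      by (rule card_mono[OF finite_pairs link_pairs_sub])
    hence "?p c \<le> P2" unfolding P2_def by (simp add: n_subsets[OF finite_V])
    thus ?thesis unfolding x_def using npos by simp
  qed
  have y01: "0 \<le> y c" "y c \<le> 1" for c
    using card_mono[OF finite_V nbr_sub[of c]] npos unfolding y_def n_def by auto
  let ?L = "{A \<in> \<F>. ?p (ctr A) < \<eta>\<^sup>2 * n\<^sup>2}"
  have star: "real (card {A \<in> \<F>. ctr A = c}) \<le> N * (x c * y c)" for c
  proof -
    have "card {A \<in> \<F>. ctr A = c} * card V * (card V choose 2)
      \<le> card (link_pairs c) * card (nbr c) * (card V choose (k - 1))"
      using n(1) by (intro card_star_le) auto
    hence "real (card {A \<in> \<F>. ctr A = c} * card V * (card V choose 2))
      \<le> real (card (link_pairs c) * card (nbr c) * (card V choose (k - 1)))" by (rule of_nat_mono)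
    hence "real (card {A \<in> \<F>. ctr A = c}) * (n * P2) \<le> ?p c * ?d c * N"
      unfolding n_def P2_def N_def by (simp only: of_nat_mult mult.assoc)
    hence "real (card {A \<in> \<F>. ctr A = c}) \<le> ?p c * ?d c * N / (n * P2)"
      using npos by (simp add: pos_le_divide_eq)
    thus ?thesis unfolding x_def y_def by (simp add: mult_ac)
  qed
  have "\<F> \<subseteq> (\<Union>c\<in>H. {A \<in> \<F>. ctr A = c}) \<union> ?L"
  proof
    fix A assume A: "A \<in> \<F>"
    hence "ctr A \<in> V" using ctr_in[OF A] edge_sub[OF A] by auto
    thus "A \<in> (\<Union>c\<in>H. {A \<in> \<F>. ctr A = c}) \<union> ?L" using A unfolding H_def by auto
  qed
  hence "card \<F> \<le> card ((\<Union>c\<in>H. {A \<in> \<F>. ctr A = c}) \<union> ?L)"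
    using finH finite_F by (intro card_mono) auto
  also have "\<dots> \<le> card (\<Union>c\<in>H. {A \<in> \<F>. ctr A = c}) + card ?L" by (rule card_Un_le)
  finally have "real (card \<F>) \<le> real (card (\<Union>c\<in>H. {A \<in> \<F>. ctr A = c})) + real (card ?L)"
    by linarith
  also have "\<dots> \<le> (\<Sum>c\<in>H. N * (x c * y c)) + 2 * real (k * l) * \<eta> * n ^ (k - 1)"
    using card_UN_le_sum[OF finH, of "\<lambda>c. {A \<in> \<F>. ctr A = c}"] star card_light_edges[OF \<eta>]
    unfolding n_def by (intro add_mono) auto
  also have "2 * real (k * l) * \<eta> * n ^ (k - 1) \<le> 2 * real (k * l) * \<eta> * (q * N)"
    using nN \<eta> by (intro mult_left_mono) auto
  also have "\<dots> = (2 * real (k * l) * \<eta> * q) * N" by simp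
  also have "\<dots> \<le> \<alpha> / 6 * N" using q(2) npos by (intro mult_right_mono) auto
  finally have up: "real (card \<F>) \<le> N * (\<Sum>c\<in>H. x c * y c) + \<alpha> / 6 * N"
    by (simp add: sum_distrib_left)
  have "\<delta> * n ^ (k - 1) \<le> \<delta> * (q * N)" using nN \<delta> by (rule mult_left_mono)
  also have "\<dots> = (\<delta> * q) * N" by simp
  also have "\<dots> \<le> \<alpha> / 6 * N" using q(3) npos by (intro mult_right_mono) auto
  finally have "real half_length * N - \<alpha> / 6 * N \<le> real (card \<F>)"
    using F unfolding n_def N_def by linarith
  hence "N * (real half_length - \<alpha> / 3) \<le> N * (\<Sum>c\<in>H. x c * y c)"
    using up by (simp add: algebra_simps)
  hence xy: "real half_length - \<alpha> / 3 \<le> (\<Sum>c\<in>H. x c * y c)" using npos by simp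
  have sx: "(\<Sum>c\<in>H. x c) \<le> real half_length + \<alpha> / 6"
    using sp npos unfolding x_def by (simp add: sum_divide_distrib[symmetric] field_simps)
  define G where "G = {c \<in> H. 1 - \<alpha> \<le> y c}"
  have GH: "G \<subseteq> H" unfolding G_def by blast
  \<comment> \<open>Markov's inequality for the weights \<open>x\<close>: outside \<open>G\<close>
    the defect \<open>1 - y c\<close> exceeds \<open>\<alpha>\<close>, while the total weighted
    defect is at most \<open>\<alpha> / 6 + \<alpha> / 3\<close>.\<close>
  have "\<alpha> * (\<Sum>c\<in>H - G. x c) = (\<Sum>c\<in>H - G. x c * \<alpha>)" by (simp add: sum_distrib_left mult.commute)
  also have "\<dots> \<le> (\<Sum>c\<in>H - G. x c * (1 - y c))"
    unfolding G_def using x0 by (intro sum_mono mult_left_mono) auto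
  also have "\<dots> \<le> (\<Sum>c\<in>H. x c * (1 - y c))"
    using finH x0 y01 by (intro sum_mono2) auto
  also have "\<dots> = (\<Sum>c\<in>H. x c) - (\<Sum>c\<in>H. x c * y c)"
    by (simp add: right_diff_distrib sum_subtractf)
  also have "\<dots> \<le> \<alpha> * (1 / 2)" using sx xy by simp
  finally have HG: "(\<Sum>c\<in>H - G. x c) \<le> 1 / 2" using \<alpha> by simp
  have "real half_length - \<alpha> / 3 \<le> (\<Sum>c\<in>H. x c)"
    using xy sum_mono[of H "\<lambda>c. x c * y c" x] x0 y01 by (simp add: mult_left_le)
  also have "\<dots> = (\<Sum>c\<in>H - G. x c) + (\<Sum>c\<in>G. x c)" by (rule sum.subset_diff[OF GH finH])
  also have "(\<Sum>c\<in>G. x c) \<le> (\<Sum>c\<in>G. 1)" using x1 by (intro sum_mono)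
  \<comment> \<open>The losses \<open>1 / 2\<close> and \<open>\<alpha> / 3\<close> together stay
    below 1, so integrality yields the full number of centres.\<close>
  finally have "real half_length - 1 < real (card G)" using HG \<alpha> by simp
  hence "half_length \<le> card G" by linarith
  then obtain S where S: "S \<subseteq> G" "card S = half_length" by (metis obtain_subset_with_card_n)
  have "(1 - \<alpha>) * real (card V) \<le> ?d a" if "a \<in> S" for a
  proof -
    have "1 - \<alpha> \<le> ?d a / n" using that S(1) unfolding G_def y_def by auto
    thus ?thesis using npos unfolding n_def by (simp add: field_simps)
  qed
  moreover have "S \<subseteq> V" using S(1) unfolding G_def H_def by auto
  ultimately show ?thesis using S(2) by blast
qed

end

section \<open>Choice of constants and passage to little-o\<close>

lemma near_extremal_stars:
  fixes k l t :: nat and \<epsilon> :: real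
  assumes kl: "4 \<le> k" "3 \<le> l" and t: "t = (l - 1) div 2" and \<epsilon>: "0 < \<epsilon>"
  obtains \<delta> :: real and n0 :: nat where "0 < \<delta>"
    and "\<And>n \<F>. \<lbrakk>n0 \<le> n; \<F> \<subseteq> k_subsets n k; centralized (k * l) \<F>; \<not> contains_linear_cycle k l \<F>;
        real t * real (n choose (k - 1)) - \<delta> * real n ^ (k - 1) \<le> real (card \<F>)\<rbrakk> \<Longrightarrow>
      \<exists>S T. S \<subseteq> {1..n} \<and> T \<subseteq> {1..n} \<and> S \<inter> T = {} \<and> card S = t \<and>
        real n - \<epsilon> * real n \<le> real (card T) \<and> (\<forall>a\<in>S. \<forall>x\<in>T. {a, x} \<in> Ker2 (k * l) \<F>)"
proof -
  have t1: "1 \<le> t" unfolding t using kl by linarith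
  \<comment> \<open>Each of the \<open>t\<close> neighbourhoods may miss \<open>\<alpha> * n\<close>
    vertices, so their intersection misses at most \<open>\<epsilon> * n\<close>.\<close>
  define \<alpha> where "\<alpha> = min 1 (\<epsilon> / real t)"
  have \<alpha>: "0 < \<alpha>" "\<alpha> \<le> 1" "real t * \<alpha> \<le> \<epsilon>"
    using t1 \<epsilon> unfolding \<alpha>_def by (auto simp: min_def field_simps)
  define q where "q = real (k - 1) ^ (k - 1)"
  have q: "0 < q" unfolding q_def using kl by simp
  have klp: "0 < real (k * l)" using kl by simp
  define \<eta> where "\<eta> = min 1 (\<alpha> / (12 * real (k * l) * q))"
  have \<eta>: "0 < \<eta>" "\<eta> \<le> 1" unfolding \<eta>_def using \<alpha> q klp by auto
  have "\<eta> \<le> \<alpha> / (12 * real (k * l) * q)" unfolding \<eta>_def by simp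
  hence "\<eta> * (12 * real (k * l) * q) \<le> \<alpha>" using q klp by (simp add: pos_le_divide_eq)
  hence \<eta>q: "2 * real (k * l) * \<eta> * q \<le> \<alpha> / 6" by (simp add: mult_ac)
  define \<delta> where "\<delta> = \<alpha> / (6 * q)"
  have \<delta>: "0 < \<delta>" "\<delta> * q \<le> \<alpha> / 6" unfolding \<delta>_def using \<alpha> q by auto
  define M where "M = nat \<lceil>(real t + 1) / \<eta>\<^sup>2\<rceil>"
  have "(real t + 1) / \<eta>\<^sup>2 \<le> real M" unfolding M_def by (rule real_nat_ceiling_ge)
  hence M: "real t + 1 \<le> real M * \<eta>\<^sup>2" using \<eta> by (simp add: pos_divide_le_eq)
  define C where "C = real (M * (2 ^ M * 2 ^ t))"
  \<comment> \<open>The second summand gives \<open>6 * C / \<alpha> <= n\<close>, and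
    \<open>n\<close> is at most \<open>n choose 2\<close> from 4 on; so \<open>C\<close> is absorbed
    as \<open>exists_full_stars\<close> requires.\<close>
  define n0 where "n0 = k + nat \<lceil>6 * C / \<alpha>\<rceil>"
  show thesis
  proof (rule that[OF \<delta>(1), of n0])
    fix n \<F>
    assume n: "n0 \<le> n" and F: "\<F> \<subseteq> k_subsets n k" and cen: "centralized (k * l) \<F>"
      and nc: "\<not> contains_linear_cycle k l \<F>"
      and cF: "real t * real (n choose (k - 1)) - \<delta> * real n ^ (k - 1) \<le> real (card \<F>)"
    from cen obtain ctr where ctr: "\<And>A. A \<in> \<F> \<Longrightarrow> ctr A \<in> A"
      "\<And>A D. A \<in> \<F> \<Longrightarrow> D \<subset> A \<Longrightarrow> ctr A \<in> D \<Longrightarrow> D \<in> Ker (k * l) \<F>"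
      unfolding centralized_def by metis
    interpret centralized_family "{1..n}" k l \<F> ctr
      by unfold_locales (use kl F ctr nc in \<open>auto simp: k_subsets_def\<close>)
    have ht: "half_length = t" unfolding half_length_def t ..
    have kn: "k \<le> n" using n unfolding n0_def by simp
    have "6 * C / \<alpha> \<le> real (nat \<lceil>6 * C / \<alpha>\<rceil>)" by (rule real_nat_ceiling_ge)
    also have "\<dots> \<le> real n" using n unfolding n0_def by linarith
    also have "\<dots> \<le> (real n / real 2) ^ 2"
    proof -
      have "4 * real n \<le> real n * real n" using kn kl by (intro mult_right_mono) auto
      thus ?thesis by (simp add: power2_eq_square)
    qed
    also have "\<dots> \<le> real (n choose 2)" using kn kl by (intro binomial_ge_n_over_k_pow_k) auto
    finally have "C \<le> \<alpha> / 6 * real (n choose 2)" using \<alpha> by (simp add: field_simps)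
    hence "\<exists>S\<subseteq>{1..n}. card S = half_length \<and>
        (\<forall>a\<in>S. (1 - \<alpha>) * real (card {1..n}) \<le> real (card (nbr a)))"
      using \<delta> \<eta>q M kn cF unfolding C_def
      by (intro exists_full_stars[where \<delta> = \<delta> and M = M, OF \<alpha>(1,2) \<eta> _ q_def]) (simp_all add: ht)
    then obtain S where S: "S \<subseteq> {1..n}" "card S = t"
      "\<And>a. a \<in> S \<Longrightarrow> (1 - \<alpha>) * real n \<le> real (card (nbr a))" by (auto simp: ht)
    have finS: "finite S" using S(1) finite_subset by blast
    \<comment> \<open>For empty \<open>S\<close> the intersection \<open>T\<close> would be the
      whole type and not a subset of \<open>{1..n}\<close>.\<close>
    have "S \<noteq> {}" using S(2) t1 by auto
    define T where "T = (\<Inter>a\<in>S. nbr a)"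
    have TV: "T \<subseteq> {1..n}" unfolding T_def using \<open>S \<noteq> {}\<close> nbr_sub by fastforce
    have "S \<inter> T = {}" unfolding T_def using not_in_nbr by auto
    have "real (card (\<Union>a\<in>S. {1..n} - nbr a)) \<le> real (card S) * (\<alpha> * real n)"
    proof (rule card_UN_le_mult[OF finS])
      fix a assume a: "a \<in> S"
      have "card ({1..n} - nbr a) = n - card (nbr a)"
        using nbr_sub[of a] finite_nbr[of a] by (simp add: card_Diff_subset)
      moreover have "card (nbr a) \<le> n" using card_mono[OF _ nbr_sub[of a]] by simp
      ultimately show "real (card ({1..n} - nbr a)) \<le> \<alpha> * real n"
        using S(3)[OF a] by (simp add: algebra_simps of_nat_diff)
    qed
    also have "\<dots> = (real t * \<alpha>) * real n" using S(2) by simp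
    also have "\<dots> \<le> \<epsilon> * real n" using \<alpha>(3) by (rule mult_right_mono) simp
    also have "(\<Union>a\<in>S. {1..n} - nbr a) = {1..n} - T" unfolding T_def by blast
    also have "card ({1..n} - T) = n - card T"
      using TV finite_subset[OF TV] by (simp add: card_Diff_subset)
    finally have "real n - \<epsilon> * real n \<le> real (card T)" by linarith
    moreover have "{a, x} \<in> Ker2 (k * l) \<F>" if "a \<in> S" "x \<in> T" for a x
      using that unfolding T_def nbr_def by auto
    ultimately show "\<exists>S T. S \<subseteq> {1..n} \<and> T \<subseteq> {1..n} \<and> S \<inter> T = {} \<and> card S = t \<and>
        real n - \<epsilon> * real n \<le> real (card T) \<and> (\<forall>a\<in>S. \<forall>x\<in>T. {a, x} \<in> Ker2 (k * l) \<F>)"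
      using S(1,2) TV \<open>S \<inter> T = {}\<close> by (intro exI[of _ S] exI[of _ T]) auto
  qed
qed

theorem theorem9p1:
  fixes k l t s :: nat and g :: "nat \<Rightarrow> real"
  assumes "k \<ge> 4" and "l \<ge> 3"
    and "t = (l - 1) div 2" and "s = k * l"
    and "g \<in> o(\<lambda>n. real n ^ (k - 1))"
  shows "\<exists>(h :: nat \<Rightarrow> real) (n1 :: nat). h \<in> o(\<lambda>n. real n) \<and>
    (\<forall>n\<ge>n1. \<forall>\<F>. \<F> \<subseteq> k_subsets n k \<and> centralized s \<F>
        \<and> \<not> contains_linear_cycle k l \<F>
        \<and> real (card \<F>) \<ge> real t * real (n choose (k - 1)) - g n
      \<longrightarrow> (\<exists>S T. S \<subseteq> {1..n} \<and> T \<subseteq> {1..n} \<and> S \<inter> T = {}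
            \<and> card S = t \<and> real (card T) \<ge> real n - h n
            \<and> (\<forall>a\<in>S. \<forall>x\<in>T. {a, x} \<in> Ker2 s \<F>)))"
proof -
  define hyp where "hyp n \<F> \<longleftrightarrow> \<F> \<subseteq> k_subsets n k \<and> centralized s \<F>
        \<and> \<not> contains_linear_cycle k l \<F>
        \<and> real (card \<F>) \<ge> real t * real (n choose (k - 1)) - g n" for n \<F>
  define ok where "ok n r \<F> \<longleftrightarrow> (\<exists>S T. S \<subseteq> {1..n} \<and> T \<subseteq> {1..n} \<and> S \<inter> T = {}
            \<and> card S = t \<and> real (card T) \<ge> real n - r
            \<and> (\<forall>a\<in>S. \<forall>x\<in>T. {a, x} \<in> Ker2 s \<F>))" for n r \<F>
  \<comment> \<open>The permitted number \<open>m\<close> of missing vertices is a natural number,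
    so that a least one can be taken.\<close>
  define good where "good n m \<longleftrightarrow> (\<forall>\<F>. hyp n \<F> \<longrightarrow> ok n (real m) \<F>)" for n m
  have ev: "eventually (\<lambda>n. good n (nat \<lfloor>\<epsilon> * real n\<rfloor>)) sequentially" if \<epsilon>: "0 < \<epsilon>" for \<epsilon> :: real
  proof -
    obtain \<delta> n0 where \<delta>: "0 < \<delta>" and st: "\<And>n \<F>. \<lbrakk>n0 \<le> n; \<F> \<subseteq> k_subsets n k;
        centralized (k * l) \<F>; \<not> contains_linear_cycle k l \<F>;
        real t * real (n choose (k - 1)) - \<delta> * real n ^ (k - 1) \<le> real (card \<F>)\<rbrakk> \<Longrightarrow>
      \<exists>S T. S \<subseteq> {1..n} \<and> T \<subseteq> {1..n} \<and> S \<inter> T = {} \<and> card S = t \<and>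
        real n - \<epsilon> * real n \<le> real (card T) \<and> (\<forall>a\<in>S. \<forall>x\<in>T. {a, x} \<in> Ker2 (k * l) \<F>)"
      using near_extremal_stars[OF assms(1,2,3) \<epsilon>] by (metis (no_types, lifting))
    have "eventually (\<lambda>n. norm (g n) \<le> \<delta> * norm (real n ^ (k - 1))) sequentially"
      using landau_o.smallD[OF assms(5) \<delta>] .
    moreover have "eventually (\<lambda>n. n0 \<le> n) sequentially" by (rule eventually_ge_at_top)
    ultimately show ?thesis
    proof eventually_elim
      case (elim n)
      show ?case
        unfolding good_def
      proof (intro allI impI)
        fix \<F> assume h: "hyp n \<F>"
        have "g n \<le> \<delta> * real n ^ (k - 1)" using elim(1) by simp
        hence "real t * real (n choose (k - 1)) - \<delta> * real n ^ (k - 1) \<le> real (card \<F>)"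
          using h unfolding hyp_def by linarith
        then obtain S T where ST: "S \<subseteq> {1..n}" "T \<subseteq> {1..n}" "S \<inter> T = {}" "card S = t"
          "real n - \<epsilon> * real n \<le> real (card T)" "\<forall>a\<in>S. \<forall>x\<in>T. {a, x} \<in> Ker2 (k * l) \<F>"
          using st[OF elim(2), of \<F>] h assms(4) unfolding hyp_def by auto
        \<comment> \<open>The number of missing vertices is an integer, so rounding the bound down
          loses nothing.\<close>
        have "real_of_int (int n - int (card T)) \<le> \<epsilon> * real n" using ST(5) by simp
        hence "int n - int (card T) \<le> \<lfloor>\<epsilon> * real n\<rfloor>" by (simp only: le_floor_iff)
        hence "real n - real (nat \<lfloor>\<epsilon> * real n\<rfloor>) \<le> real (card T)" by linarith
        thus "ok n (real (nat \<lfloor>\<epsilon> * real n\<rfloor>)) \<F>"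
          unfolding ok_def using ST assms(4) by (intro exI[of _ S] exI[of _ T]) simp
      qed
    qed
  qed
  \<comment> \<open>A single \<open>h\<close> must serve all \<open>\<epsilon>\<close> at once. The
    least good value lies below every bound \<open>\<epsilon> * n\<close> as soon as that bound is
    good, which makes a diagonal choice of \<open>\<epsilon>\<close> unnecessary.\<close>
  define h where "h n = real (LEAST m. good n m)" for n
  have "h \<in> o(\<lambda>n. real n)"
  proof (rule landau_o.smallI)
    fix c :: real assume c: "0 < c"
    show "eventually (\<lambda>n. norm (h n) \<le> c * norm (real n)) sequentially"
      using ev[OF c]
    proof eventually_elim
      case (elim n)
      have "(LEAST m. good n m) \<le> nat \<lfloor>c * real n\<rfloor>" using elim by (rule Least_le)
      also have "real (nat \<lfloor>c * real n\<rfloor>) \<le> c * real n" using c by (simp add: of_nat_floor)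
      finally show ?case unfolding h_def by simp
    qed
  qed
  \<comment> \<open>The case \<open>\<epsilon> = 1\<close> shows that some good value exists from
    \<open>n1\<close> on, so there \<open>LEAST\<close> really selects a good one.\<close>
  moreover obtain n1 where n1: "\<And>n. n1 \<le> n \<Longrightarrow> good n (nat \<lfloor>1 * real n\<rfloor>)"
    using ev[of 1] unfolding eventually_sequentially by auto
  have "ok n (h n) \<F>" if "n1 \<le> n" "hyp n \<F>" for n \<F>
    using LeastI[of "good n", OF n1[OF that(1)]] that(2) unfolding h_def good_def by blast
  ultimately show ?thesis
    unfolding hyp_def ok_def by (intro exI[of _ h] exI[of _ n1]) simp
qed

end
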